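(* Assume that $\dim_{\mathbb{K}}\mathbf{f}=2$. Then $\mathrm{Res}_{tv}(\mathbf{x}\mathbf{A},\mathbf{x}\mathbf{B})$ is a nonzero polynomial in $\mathbb{K}[w,x,y,z]$ and factors as $\mathrm{Res}_{tv}(\mathbf{x}\mathbf{A},\mathbf{x}\mathbf{B})=EF$ with $E,F\in\mathbb{K}[w,x,y,z]$, where $F$ is the implicit equation of $X_{\mathbf{h}}$.
   Context: $\mathbb{K}$ is an algebraically closed field of characteristic zero and $R=\mathbb{K}[s,u,t,v]$. Let $\mathbf{f}=(f_0,f_1,f_2,f_3)$ with $f_i\in\mathbb{K}[s,u]$ homogeneous of degree $m\ge 1$, and $\mathbf{g}=(g_0,g_1,g_2,g_3)$ with $g_i\in\mathbb{K}[t,v]$ homogeneous of degree $n\geq 1$, where $\gcd(f_0,\dots,f_3)=1=\gcd(g_0,\dots,g_3)$ and $f_0\neq 0$, $g_0\ne 0$. Write $\dim_{\mathbb{K}}\mathbf{f}$ for the dimension of the $\mathbb{K}$-vector space spanned by $f_0,f_1,f_2,f_3$. Let $\mathbf{h}=(h_0,h_1,h_2,h_3)$ with $h_i=f_0g_i+f_ig_0\in R$; it defines a rational map $\mathbb{P}^1\times\mathbb{P}^1\dashrightarrow\mathbb{P}^3$ with image $X_{\mathbf{h}}$, which is assumed to be a surface (its Zariski closure has dimension 2). The implicit equation of $X_{\mathbf{h}}$ is the irreducible homogeneous polynomial in $\mathbb{K}[w,x,y,z]$ (unique up to unit) whose zero locus in $\mathbb{P}^3$ is the Zariski closure of $X_{\mathbf{h}}$.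 The module $\mathrm{syz}(\mathbf{f})$ of syzygies of $(f_0,f_1,f_2,f_3)$ over $\mathbb{K}[s,u]$ is graded free of rank 3; let $\mathbf{a},\mathbf{b},\mathbf{c}$ (column vectors of length 4) be a homogeneous basis, with entries homogeneous of degrees $\mu_1\le\mu_2\le\mu_3$ respectively, $\mu_1+\mu_2+\mu_3=m$. Let $$N_{\mathbf{g}}=\begin{bmatrix}\frac{g_0}{2}&-\frac{g_1}{2}&-\frac{g_2}{2}&-\frac{g_3}{2}\\0&g_0&0&0\\0&0&g_0&0\\0&0&0&g_0\end{bmatrix}.$$ For a vector, $\gcd(\cdot)$ is the greatest common divisor in $R$ of its entries. Set $\mathbf{A}=\frac{N_{\mathbf{g}}\mathbf{a}}{\gcd(N_{\mathbf{g}}\mathbf{a})}$ and $\mathbf{B}=\frac{N_{\mathbf{g}}\mathbf{b}}{\gcd(N_{\mathbf{g}}\mathbf{b})}$. Let $\mathbf{x}=[w,x,y,z]$ be coordinates on $\mathbb{P}^3$. When $\dim_{\mathbb{K}}\mathbf{f}=2$ one has $\mu_1=\mu_2=0$, so $\mathbf{A},\mathbf{B}$ have entries in $\mathbb{K}[t,v]$ and $\mathbf{x}\mathbf{A},\mathbf{x}\mathbf{B}\in\mathbb{K}[t,v,w,x,y,z]$ are homogeneous in $t,v$. For polynomials $p,q$ homogeneous of degrees $d,e$ in $t,v$ with coefficients in $\mathbb{K}[w,x,y,z]$, $\mathrm{Res}_{tv}(p,q)$ is the determinant of the homogeneous Sylvester $(d+e)\times(d+e)$ matrix ($e$ shifted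 rows of coefficients of $p$, then $d$ shifted rows of coefficients of $q$; the empty determinant is $1$). *)

theory Defs
  imports
    "HOL-Computational_Algebra.Computational_Algebra"
    "HOL-Library.Extended_Nat"
    "Subresultants.Resultant_Prelim"
begin

text \<open>
  Polynomial rings are iterated univariate ones, the first variable being the outermost:
  in \<open>'a bipoly\<close>, standing for \<open>K[s,u]\<close> or \<open>K[t,v]\<close>, the coefficient of
  \<open>s^i u^j\<close> in \<open>p\<close> is \<open>coeff (coeff p i) j\<close>; in \<open>'a quadpoly\<close>,
  standing for \<open>R = K[s,u,t,v] = K[t,v][s,u]\<close> or \<open>K[w,x,y,z]\<close>, it is read off likewise.
  The ring \<open>K[t,v,w,x,y,z]\<close> is taken as \<open>K[w,x,y,z][t,v]\<close>, i.e. \<open>'a quadpoly bipoly\<close>.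
  Vectors of polynomials or scalars have length 4.
\<close>

type_synonym 'a bipoly = "'a poly poly"
type_synonym 'a quadpoly = "'a poly poly poly poly"

definition homogeneous2 :: "nat \<Rightarrow> 'a::zero bipoly \<Rightarrow> bool" where
  "homogeneous2 d p \<longleftrightarrow> (\<forall>i j. coeff (coeff p i) j \<noteq> 0 \<longrightarrow> i + j = d)"

definition homogeneous4 :: "nat \<Rightarrow> 'a::zero quadpoly \<Rightarrow> bool" where
  "homogeneous4 d p \<longleftrightarrow>
     (\<forall>i j k l. coeff (coeff (coeff (coeff p i) j) k) l \<noteq> 0 \<longrightarrow> i + j + k + l = d)"

definition eval4 :: "'a::comm_ring_1 quadpoly \<Rightarrow> 'a vec \<Rightarrow> 'a" where
  "eval4 p c = poly (poly (poly (poly p [:[:[:c $ 0:]:]:]) [:[:c $ 1:]:]) [:c $ 2:]) (c $ 3)"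

text \<open>The inclusions of \<open>K[s,u]\<close> and \<open>K[t,v]\<close> into \<open>R\<close>.\<close>

definition su_to_R :: "'a::comm_ring_1 bipoly \<Rightarrow> 'a quadpoly" where
  "su_to_R p = map_poly (map_poly (\<lambda>c. [:[:c:]:])) p"

definition tv_to_R :: "'a::comm_ring_1 bipoly \<Rightarrow> 'a quadpoly" where
  "tv_to_R p = [:[:p:]:]"

text \<open>
  A greatest common divisor is determined only up to a unit, so it is a relation; no
  normalisation (and hence no extra type class on the field) is involved.
\<close>

definition is_gcd_set :: "'r::comm_ring_1 \<Rightarrow> 'r set \<Rightarrow> bool" where
  "is_gcd_set d S \<longleftrightarrow> (\<forall>x\<in>S. d dvd x) \<and> (\<forall>e. (\<forall>x\<in>S. e dvd x) \<longrightarrow> e dvd d)"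

definition dim_span :: "'a::field bipoly vec \<Rightarrow> nat" where
  "dim_span f = vector_space.dim (\<lambda>c. Polynomial.smult [:c:]) (set\<^sub>v f)"

definition syz :: "'r::comm_ring_1 vec \<Rightarrow> 'r vec set" where
  "syz f = {p \<in> carrier_vec (dim_vec f). f \<bullet> p = 0}"

definition is_syz_basis :: "'r::comm_ring_1 vec \<Rightarrow> 'r vec \<Rightarrow> 'r vec \<Rightarrow> 'r vec \<Rightarrow> bool" where
  "is_syz_basis f a b c \<longleftrightarrow> a \<in> syz f \<and> b \<in> syz f \<and> c \<in> syz f \<and>
     (\<forall>p \<in> syz f. \<exists>!(\<alpha>, \<beta>, \<gamma>). p = \<alpha> \<cdot>\<^sub>v a + \<beta> \<cdot>\<^sub>v b + \<gamma> \<cdot>\<^sub>v c)"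

definition N_mat :: "'a::field bipoly vec \<Rightarrow> 'a bipoly mat" where
  "N_mat g = mat_of_rows_list 4
     [[Polynomial.smult [:1/2:] (g $ 0), - Polynomial.smult [:1/2:] (g $ 1), - Polynomial.smult [:1/2:] (g $ 2), - Polynomial.smult [:1/2:] (g $ 3)],
      [0, g $ 0, 0, 0],
      [0, 0, g $ 0, 0],
      [0, 0, 0, g $ 0]]"

text \<open>The product \<open>N a\<close> over \<open>R\<close>, for \<open>N\<close> built from \<open>g\<close> and \<open>a\<close> over \<open>K[s,u]\<close>.\<close>

definition N_mult :: "'a::field bipoly vec \<Rightarrow> 'a bipoly vec \<Rightarrow> 'a quadpoly vec" where
  "N_mult g a = map_mat tv_to_R (N_mat g) *\<^sub>v map_vec su_to_R a"

definition h_vec :: "'a::field bipoly vec \<Rightarrow> 'a bipoly vec \<Rightarrow> 'a quadpoly vec" where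
  "h_vec f g = vec 4 (\<lambda>i. su_to_R (f $ 0) * tv_to_R (g $ i) + su_to_R (f $ i) * tv_to_R (g $ 0))"

text \<open>
  Projective 3-space: a point is the set of all homogeneous coordinate vectors representing it.
\<close>

definition proj_point :: "'a::field vec \<Rightarrow> 'a vec set" where
  "proj_point p = {c \<cdot>\<^sub>v p | c. c \<noteq> 0}"

definition proj_zeros :: "'a::field quadpoly set \<Rightarrow> 'a vec set set" where
  "proj_zeros S = {proj_point p | p. p \<in> carrier_vec 4 \<and> p \<noteq> 0\<^sub>v 4 \<and> (\<forall>F\<in>S. eval4 F p = 0)}"

definition zariski_closed :: "'a::field vec set set \<Rightarrow> bool" where
  "zariski_closed Z \<longleftrightarrow> (\<exists>S. (\<forall>F\<in>S. \<exists>d. homogeneous4 d F) \<and> Z = proj_zeros S)"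

definition zariski_closure :: "'a::field vec set set \<Rightarrow> 'a vec set set" where
  "zariski_closure X = \<Inter>{Z. zariski_closed Z \<and> X \<subseteq> Z}"

definition irreducible_closed :: "'a::field vec set set \<Rightarrow> bool" where
  "irreducible_closed Z \<longleftrightarrow> zariski_closed Z \<and> Z \<noteq> {} \<and>
     (\<forall>Z1 Z2. zariski_closed Z1 \<longrightarrow> zariski_closed Z2 \<longrightarrow> Z = Z1 \<union> Z2 \<longrightarrow> Z = Z1 \<or> Z = Z2)"

text \<open>Krull dimension of a closed subset of projective 3-space (0 for the empty set).\<close>

definition zariski_dim :: "'a::field vec set set \<Rightarrow> enat" where
  "zariski_dim X = Sup {enat d | d. \<exists>Z. (\<forall>i\<le>d. irreducible_closed (Z i) \<and> Z i \<subseteq> X) \<and>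
                                        (\<forall>i<d. Z i \<subset> Z (Suc i))}"

text \<open>
  The image of the rational map from the product of two projective lines defined by \<open>h\<close>;
  the points at which all entries of \<open>h\<close> vanish are excluded.
\<close>

definition rational_image :: "'a::field quadpoly vec \<Rightarrow> 'a vec set set" where
  "rational_image h = {proj_point p | p s u t v. (s, u) \<noteq> (0, 0) \<and> (t, v) \<noteq> (0, 0) \<and>
     p = map_vec (\<lambda>q. eval4 q (vec_of_list [s, u, t, v])) h \<and> p \<noteq> 0\<^sub>v 4}"

definition is_implicit_equation :: "'a::field quadpoly \<Rightarrow> 'a vec set set \<Rightarrow> bool" where
  "is_implicit_equation F X \<longleftrightarrow>
     Factorial_Ring.irreducible F \<and> (\<exists>d. homogeneous4 d F) \<and> proj_zeros {F} = zariski_closure X"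

text \<open>The row vector \<open>[w,x,y,z]\<close> over \<open>K[w,x,y,z]\<close>.\<close>

definition wxyz :: "'a::comm_ring_1 quadpoly vec" where
  "wxyz = vec_of_list [[:0, 1:], [:[:0, 1:]:], [:[:[:0, 1:]:]:], [:[:[:[:0, 1:]:]:]:]]"

text \<open>The form \<open>x A\<close> in \<open>K[w,x,y,z][t,v]\<close>, for \<open>A\<close> with entries in \<open>K[t,v]\<close>.\<close>

definition x_mult :: "'a::comm_ring_1 bipoly vec \<Rightarrow> 'a quadpoly bipoly" where
  "x_mult A = map_vec (\<lambda>c. [:[:c:]:]) wxyz \<bullet> map_vec (map_poly (map_poly (\<lambda>c. [:[:[:[:c:]:]:]:]))) A"

text \<open>
  The homogeneous resultant of forms \<open>p\<close>, \<open>q\<close> of degrees \<open>d\<close>, \<open>e\<close> in \<open>t\<close>, \<open>v\<close>.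
  Setting \<open>v = 1\<close> keeps the coefficient of \<open>t^i v^(d-i)\<close> as that of \<open>t^i\<close>; since the Sylvester
  matrix is formed for the degrees \<open>d\<close>, \<open>e\<close>, vanishing leading coefficients are kept.
\<close>

definition Res_tv :: "nat \<Rightarrow> nat \<Rightarrow> 'r::comm_ring_1 bipoly \<Rightarrow> 'r bipoly \<Rightarrow> 'r" where
  "Res_tv d e p q = det (sylvester_mat_sub d e (map_poly (\<lambda>c. poly c 1) p) (map_poly (\<lambda>c. poly c 1) q))"

end

theory Submission
  imports Defs "Berlekamp_Zassenhaus.Unique_Factorization_Poly"
begin

text \<open>
  Since the span of \<open>f\<close> is two-dimensional, \<open>f = f\<^sub>0 \<alpha> + f\<^sub>j \<beta>\<close> with constant vectors \<open>\<alpha>, \<beta>\<close>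
  satisfying \<open>\<alpha>\<^sub>0 = 1\<close> and \<open>\<beta>\<^sub>0 = 0\<close>. With \<open>G = g + g\<^sub>0 \<alpha>\<close> this gives \<open>h = f\<^sub>0 G + (f\<^sub>j g\<^sub>0) \<beta>\<close>,
  so \<open>X\<^sub>h\<close> is the cone with vertex \<open>\<beta>\<close> over the curve \<open>G\<close>; the coprime pair \<open>f\<^sub>0, f\<^sub>j\<close> maps \<open>K\<^sup>2\<close>
  onto \<open>K\<^sup>2\<close>, hence every \<open>x G(t,v) + y \<beta>\<close> with \<open>x g\<^sub>0(t,v) \<noteq> 0\<close> is a value of \<open>h\<close>.

  The syzygies \<open>a, b\<close> are constant vectors, and the planes \<open>A(t,v), B(t,v)\<close> contain the ruling
  over \<open>(t,v)\<close>. So the resultant vanishes on the cone; it is nonzero because after removing the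
  greatest common divisors the two forms have no common zero at a generic point of space.
  As the ideal of forms vanishing on the parametrised cone is prime, some irreducible factor \<open>F\<close> of
  the resultant vanishes on \<open>X\<^sub>h\<close>. This \<open>F\<close> generates that ideal: if \<open>F\<close> did not divide some \<open>H\<close> in it,
  eliminating one coordinate from \<open>F\<close> and \<open>H\<close> would give a nonzero polynomial in the other three
  vanishing on the cone, although the cone projects densely along a suitable coordinate axis when
  \<open>X\<^sub>h\<close> is a surface.
\<close>

no_notation fps_nth (infixl \<open>$\<close> 75)

section \<open>Polynomials as functions\<close>

text \<open>Points are total functions, so that coordinates can be updated and permuted without
  carrier conditions; only the arguments 0 to 3 are read.\<close>

definition ev4 :: "'a::comm_ring_1 quadpoly \<Rightarrow> (nat \<Rightarrow> 'a) \<Rightarrow> 'a" where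
  "ev4 p P = poly (poly (poly (poly p [:[:[:P 0:]:]:]) [:[:P 1:]:]) [:P 2:]) (P 3)"

definition ev2 :: "'a::comm_ring_1 bipoly \<Rightarrow> 'a \<Rightarrow> 'a \<Rightarrow> 'a" where
  "ev2 p t v = poly (poly p [:t:]) v"

lemma eval4_eq_ev4: "eval4 p c = ev4 p (vec_index c)"
  by (simp add: eval4_def ev4_def)

lemma ev4_hom [simp]:
  "ev4 0 P = 0" "ev4 1 P = 1" "ev4 (p + q) P = ev4 p P + ev4 q P"
  "ev4 (p - q) P = ev4 p P - ev4 q P" "ev4 (- p) P = - ev4 p P"
  "ev4 (p * q) P = ev4 p P * ev4 q P" "ev4 [:[:[:[:c:]:]:]:] P = c"
  by (simp_all add: ev4_def)

lemma ev4_cong: "(\<And>i. i < 4 \<Longrightarrow> P i = Q i) \<Longrightarrow> ev4 p P = ev4 p Q"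
  by (simp add: ev4_def)

lemma ev4_sum [simp]: "ev4 (sum f I) P = (\<Sum>i\<in>I. ev4 (f i) P)"
  by (induction I rule: infinite_finite_induct) auto

lemma ev2_hom [simp]:
  "ev2 0 t v = 0" "ev2 1 t v = 1" "ev2 (p + q) t v = ev2 p t v + ev2 q t v"
  "ev2 (p - q) t v = ev2 p t v - ev2 q t v" "ev2 (- p) t v = - ev2 p t v"
  "ev2 (p * q) t v = ev2 p t v * ev2 q t v" "ev2 [:[:c:]:] t v = c"
  "ev2 (Polynomial.smult [:c:] p) t v = c * ev2 p t v"
  by (simp_all add: ev2_def)

lemma ev4_tv_to_R [simp]: "ev4 (tv_to_R p) P = ev2 p (P 2) (P 3)"
  by (simp add: ev4_def ev2_def tv_to_R_def)

lemma ev4_su_to_R [simp]: "ev4 (su_to_R p) P = ev2 p (P 0) (P 1)"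
proof -
  have 1: "poly (map_poly (\<lambda>c. [:[:c:]:]) q) [:[:y:]:] = [:[:poly q y:]:]"
    for q :: "'a poly" and y
    by (induction q) (auto simp: map_poly_pCons)
  have 2: "map_poly (\<lambda>c. [:[:c:]:]) (q + r) = map_poly (\<lambda>c. [:[:c:]:]) q + map_poly (\<lambda>c. [:[:c:]:]) r"
    for q r :: "'a poly"
    by (intro poly_eqI) (simp add: coeff_map_poly)
  have 3: "map_poly (\<lambda>c. [:[:c:]:]) (Polynomial.smult x q) = Polynomial.smult [:[:x:]:] (map_poly (\<lambda>c. [:[:c:]:]) q)"
    for q :: "'a poly" and x
    by (intro poly_eqI) (simp add: coeff_map_poly)
  \<comment> \<open>Evaluating the outermost variable stays inside the embedded copy of
    \<open>K[u]\<close>, because all coefficients are constants in the two inner variables.\<close>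
  have 4: "poly (map_poly (map_poly (\<lambda>c. [:[:c:]:])) q) [:[:[:x:]:]:] = map_poly (\<lambda>c. [:[:c:]:]) (poly q [:x:])"
    for q :: "'a bipoly" and x
    by (induction q) (auto simp: map_poly_pCons 2 3)
  show ?thesis
    by (simp add: ev4_def ev2_def su_to_R_def 1 4)
qed

section \<open>Polynomials determined by their values\<close>

text \<open>The range of \<open>h\<close> is an infinite set of roots. Coefficients lie in an
  arbitrary domain, so that in an iterated ring it is enough to substitute constants from the
  field.\<close>

lemma poly_eq_0_of_infinite:
  fixes p :: "'b::idom poly" and h :: "'a::field_char_0 \<Rightarrow> 'b"
  assumes "inj h" "\<And>a. poly p (h a) = 0"
  shows "p = 0"
proof (rule ccontr)
  assume "p \<noteq> 0"
  then have "finite {x. poly p x = 0}" by (rule poly_roots_finite)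
  moreover have "range h \<subseteq> {x. poly p x = 0}" using assms(2) by auto
  ultimately have "finite (range h)" by (rule rev_finite_subset)
  then have "finite (UNIV :: 'a set)" using assms(1) finite_imageD by blast
  then show False by (simp add: infinite_UNIV_char_0)
qed

lemma ev4_eq_0_imp:
  fixes p :: "'a::field_char_0 quadpoly"
  assumes "\<And>P. ev4 p P = 0"
  shows "p = 0"
proof -
  have e: "poly (poly (poly (poly p [:[:[:a:]:]:]) [:[:b:]:]) [:c:]) d = 0" for a b c d
    using assms[of "\<lambda>i. if i = 0 then a else if i = 1 then b else if i = 2 then c else d"]
    by (simp add: ev4_def)
  \<comment> \<open>The variables are removed from the innermost outwards: each time the remaining
    polynomial has all embedded field elements as roots.\<close>
  have "poly (poly (poly p [:[:[:a:]:]:]) [:[:b:]:]) [:c:] = 0" for a b c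
    by (rule poly_eq_0_of_infinite[of "\<lambda>x. x"]) (auto simp: e inj_def)
  then have "poly (poly p [:[:[:a:]:]:]) [:[:b:]:] = 0" for a b
    by (intro poly_eq_0_of_infinite[of "\<lambda>x. [:x:]"]) (auto simp: inj_def)
  then have "poly p [:[:[:a:]:]:] = 0" for a
    by (intro poly_eq_0_of_infinite[of "\<lambda>x. [:[:x:]:]"]) (auto simp: inj_def)
  then show ?thesis
    by (intro poly_eq_0_of_infinite[of "\<lambda>x. [:[:[:x:]:]:]"]) (auto simp: inj_def)
qed

lemma ev4_eq_imp:
  fixes p :: "'a::field_char_0 quadpoly"
  assumes "\<And>P. ev4 p P = ev4 q P"
  shows "p = q"
  using ev4_eq_0_imp[of "p - q"] assms by simp

text \<open>Closure rules along the shape of a function replace the explicit construction of a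
  polynomial for it.\<close>

definition polyfun :: "((nat \<Rightarrow> 'a::comm_ring_1) \<Rightarrow> 'a) \<Rightarrow> bool" where
  "polyfun \<phi> \<longleftrightarrow> (\<exists>p. \<forall>P. \<phi> P = ev4 p P)"

lemma polyfun_ev4: "polyfun (ev4 p)"
  by (auto simp: polyfun_def)

lemma polyfun_const: "polyfun (\<lambda>P. c)"
  unfolding polyfun_def by (rule exI[of _ "[:[:[:[:c:]:]:]:]"]) simp

lemma polyfun_add:
  assumes "polyfun \<phi>" "polyfun \<psi>"
  shows "polyfun (\<lambda>P. \<phi> P + \<psi> P)"
proof -
  obtain p q where "\<And>P. \<phi> P = ev4 p P" "\<And>P. \<psi> P = ev4 q P"
    using assms by (auto simp: polyfun_def)
  then show ?thesis
    unfolding polyfun_def by (intro exI[of _ "p + q"]) simp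
qed

lemma polyfun_mult:
  assumes "polyfun \<phi>" "polyfun \<psi>"
  shows "polyfun (\<lambda>P. \<phi> P * \<psi> P)"
proof -
  obtain p q where "\<And>P. \<phi> P = ev4 p P" "\<And>P. \<psi> P = ev4 q P"
    using assms by (auto simp: polyfun_def)
  then show ?thesis
    unfolding polyfun_def by (intro exI[of _ "p * q"]) simp
qed

lemma polyfun_proj:
  assumes "i < 4"
  shows "polyfun (\<lambda>P. P i :: 'a::comm_ring_1)"
proof -
  consider "i = 0" | "i = 1" | "i = 2" | "i = 3" using assms by linarith
  then show ?thesis
  proof cases
    case 1
    show ?thesis unfolding polyfun_def 1 by (rule exI[of _ "[:0,1:]"]) (simp add: ev4_def)
  next
    case 2
    show ?thesis unfolding polyfun_def 2 by (rule exI[of _ "[:[:0,1:]:]"]) (simp add: ev4_def)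
  next
    case 3
    show ?thesis unfolding polyfun_def 3 by (rule exI[of _ "[:[:[:0,1:]:]:]"]) (simp add: ev4_def)
  next
    case 4
    show ?thesis unfolding polyfun_def 4 by (rule exI[of _ "[:[:[:[:0,1:]:]:]:]"]) (simp add: ev4_def)
  qed
qed

lemma polyfun_ev2:
  assumes "polyfun \<phi>" "polyfun \<psi>"
  shows "polyfun (\<lambda>P. ev2 p (\<phi> P) (\<psi> P))"
proof -
  have 1: "polyfun (\<lambda>P. poly p (\<psi> P))" for p :: "'a poly"
    by (induction p) (simp_all add: polyfun_const polyfun_add polyfun_mult assms)
  show ?thesis unfolding ev2_def
    by (induction p) (simp_all add: 1 polyfun_const polyfun_add polyfun_mult assms)
qed

lemma polyfun_compose:
  assumes "\<And>i. i < 4 \<Longrightarrow> polyfun (\<lambda>P. L P i)"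
  shows "polyfun (\<lambda>P. ev4 p (L P))"
proof -
  have L: "polyfun (\<lambda>P. L P 0)" "polyfun (\<lambda>P. L P (Suc 0))" "polyfun (\<lambda>P. L P 2)" "polyfun (\<lambda>P. L P 3)"
    by (rule assms; simp)+
  note i = polyfun_const polyfun_add polyfun_mult L
  have 1: "polyfun (\<lambda>P. poly p (L P 3))" for p :: "'a poly"
    by (induction p) (simp_all add: i)
  have 2: "polyfun (\<lambda>P. poly (poly p [:L P 2:]) (L P 3))" for p :: "'a poly poly"
    by (induction p) (simp_all add: i 1)
  have 3: "polyfun (\<lambda>P. poly (poly (poly p [:[:L P (Suc 0):]:]) [:L P 2:]) (L P 3))"
    for p :: "'a poly poly poly"
    by (induction p) (simp_all add: i 2)
  show ?thesis unfolding ev4_def by (induction p) (simp_all add: i 3)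
qed

text \<open>Over an infinite field polynomial functions and polynomials agree, so the functions
  inherit the absence of zero divisors.\<close>

lemma polyfun_mult_eq_0:
  fixes \<phi> \<psi> :: "(nat \<Rightarrow> 'a::field_char_0) \<Rightarrow> 'a"
  assumes "polyfun \<phi>" "polyfun \<psi>" "\<And>P. \<phi> P * \<psi> P = 0"
  shows "(\<forall>P. \<phi> P = 0) \<or> (\<forall>P. \<psi> P = 0)"
proof -
  obtain p q where pq: "\<And>P. \<phi> P = ev4 p P" "\<And>P. \<psi> P = ev4 q P"
    using assms by (auto simp: polyfun_def)
  have "ev4 (p * q) P = 0" for P using assms(3)[of P] pq by simp
  then have "p * q = 0" by (rule ev4_eq_0_imp)
  then have "p = 0 \<or> q = 0" by simp
  then show ?thesis by (elim disjE) (simp_all add: pq)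
qed

text \<open>Substitution of \<open>L\<close>; the choice is arbitrary unless all coordinates of \<open>L\<close> are polynomial.\<close>

definition precomp :: "((nat \<Rightarrow> 'a) \<Rightarrow> (nat \<Rightarrow> 'a)) \<Rightarrow> 'a::field_char_0 quadpoly \<Rightarrow> 'a quadpoly" where
  "precomp L p = (SOME q. \<forall>P. ev4 q P = ev4 p (L P))"

lemma ev4_precomp:
  assumes "\<And>i. i < 4 \<Longrightarrow> polyfun (\<lambda>P. L P i)"
  shows "ev4 (precomp L p) P = ev4 p (L P)"
proof -
  have "\<exists>q. \<forall>P. ev4 q P = ev4 p (L P)"
    using polyfun_compose[of L p, OF assms] by (auto simp: polyfun_def)
  from someI_ex[OF this] show ?thesis unfolding precomp_def by auto
qed

text \<open>A polynomial substitution is a ring homomorphism and preserves divisibility; the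
  converse is the same fact for the inverse substitution.\<close>

lemma precomp_dvd_iff:
  assumes L: "\<And>i. i < 4 \<Longrightarrow> polyfun (\<lambda>P. L P i)" and M: "\<And>i. i < 4 \<Longrightarrow> polyfun (\<lambda>P. M P i)"
    and LMid: "\<And>P. M (L P) = P" and MLid: "\<And>P. L (M P) = P"
  shows "precomp L p dvd precomp L q \<longleftrightarrow> p dvd q"
proof -
  \<comment> \<open>Stated for arbitrary substitutions, since it is applied to \<open>M\<close> as
    well as to \<open>L\<close>.\<close>
  have d: "precomp L p dvd precomp L q" if "p dvd q"
    and "\<forall>i<4. polyfun (\<lambda>P. L P i)" for L and p q :: "'a quadpoly"
  proof -
    have L: "\<And>i. i < 4 \<Longrightarrow> polyfun (\<lambda>P. L P i)" using that by blast
    obtain r where "q = p * r" using \<open>p dvd q\<close> by (elim dvdE)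
    then have "precomp L q = precomp L p * precomp L r"
      by (intro ev4_eq_imp) (simp add: ev4_precomp[OF L])
    then show ?thesis by simp
  qed
  have inv: "precomp M (precomp L p) = p" for p
    by (intro ev4_eq_imp) (simp add: ev4_precomp[OF L] ev4_precomp[OF M] MLid)
  show ?thesis
  proof
    assume "precomp L p dvd precomp L q"
    from d[OF this, of M] M show "p dvd q" by (simp add: inv)
  qed (use d[of p q L] L in blast)
qed

text \<open>A factorisation of the image pulls back along \<open>M\<close> to a factorisation of
  \<open>p\<close>, and units correspond to units.\<close>

lemma precomp_irreducible:
  assumes L: "\<And>i. i < 4 \<Longrightarrow> polyfun (\<lambda>P. L P i)" and M: "\<And>i. i < 4 \<Longrightarrow> polyfun (\<lambda>P. M P i)"
    and LMid: "\<And>P. M (L P) = P" and MLid: "\<And>P. L (M P) = P"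
    and irr: "Factorial_Ring.irreducible p"
  shows "Factorial_Ring.irreducible (precomp L p)"
proof (rule irreducibleI)
  have LMid': "precomp M (precomp L p) = p" for p
    by (intro ev4_eq_imp) (simp add: ev4_precomp[OF L] ev4_precomp[OF M] MLid)
  have 1: "precomp M 1 = 1" "precomp L 1 = 1" "precomp M 0 = 0"
    by (auto intro!: ev4_eq_imp simp add: ev4_precomp[OF M] ev4_precomp[OF L])
  note dL = precomp_dvd_iff[OF L M LMid MLid]
  note dM = precomp_dvd_iff[OF M L MLid LMid]
  show "precomp L p \<noteq> 0" using LMid'[of p] 1 irr by auto
  show "\<not> is_unit (precomp L p)" using dL[of p 1] 1 irr by auto
  fix a b assume ab: "precomp L p = a * b"
  have "p = precomp M (a * b)" using ab LMid' by metis
  also have "\<dots> = precomp M a * precomp M b"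
    by (intro ev4_eq_imp) (simp add: ev4_precomp[OF M])
  finally have "is_unit (precomp M a) \<or> is_unit (precomp M b)"
    using irr irreducibleD by blast
  then show "is_unit a \<or> is_unit b" using dM[of _ 1] 1 by auto
qed

section \<open>Elimination\<close>

text \<open>A nonzero element \<open>D\<close> of least degree in the ideal divides all its elements up to constants, by pseudo-division.\<close>

lemma ideal_meets_constants:
  fixes F G :: "'b::idom poly"
  assumes F: "prime_elem F" and ndvd: "\<not> F dvd G"
  obtains r U V where "r \<noteq> 0" "[:r:] = U * F + V * G"
proof -
  define I where "I = {D. D \<noteq> 0 \<and> (\<exists>U V. D = U * F + V * G)}"
  have "F \<noteq> 0" using F by auto
  have "F = 1 * F + 0 * G" "G = 0 * F + 1 * G" by simp_all
  then have FI: "F \<in> I" using \<open>F \<noteq> 0\<close> unfolding I_def by blast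
  obtain D where D: "D \<in> I" and min: "\<And>E. E \<in> I \<Longrightarrow> degree D \<le> degree E"
    using ex_has_least_nat[of "\<lambda>D. D \<in> I" F degree] FI by blast
  have D0: "D \<noteq> 0" using D by (auto simp: I_def)
  have red: "\<exists>a Q. a \<noteq> 0 \<and> Polynomial.smult a H = D * Q" if H: "\<exists>U V. H = U * F + V * G" for H
  proof -
    obtain a Q where a: "a \<noteq> 0" and e: "Polynomial.smult a H = D * Q + pseudo_mod H D"
      using pseudo_mod(1)[OF D0] by blast
    obtain U V where "H = U * F + V * G" using H by auto
    obtain U' V' where "D = U' * F + V' * G" using D by (auto simp: I_def)
    have "pseudo_mod H D = Polynomial.smult a H - D * Q" using e by simp
    also have "\<dots> = (Polynomial.smult a U - U' * Q) * F + (Polynomial.smult a V - V' * Q) * G"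
      using \<open>H = _\<close> \<open>D = _\<close> by (simp add: algebra_simps smult_add_right)
    finally have ex: "\<exists>U V. pseudo_mod H D = U * F + V * G" by blast
    have "pseudo_mod H D = 0"
    proof (rule ccontr)
      assume "pseudo_mod H D \<noteq> 0"
      then have "pseudo_mod H D \<in> I" using ex unfolding I_def by blast
      with min have "degree D \<le> degree (pseudo_mod H D)" by blast
      then show False using pseudo_mod(2)[OF D0, of H] \<open>pseudo_mod H D \<noteq> 0\<close> by linarith
    qed
    then show ?thesis using a e by auto
  qed
  obtain a Q where a: "a \<noteq> 0" "Polynomial.smult a F = D * Q"
    using red[of F] \<open>F = 1 * F + 0 * G\<close> by blast
  obtain b R where b: "b \<noteq> 0" "Polynomial.smult b G = D * R"
    using red[of G] \<open>G = 0 * F + 1 * G\<close> by blast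
  \<comment> \<open>If the prime \<open>F\<close> divides \<open>D\<close>, it divides the constant
    \<open>b\<close>, and minimality compares \<open>D\<close> with the constant \<open>F\<close>.
    Otherwise \<open>F\<close> divides the cofactor \<open>Q\<close>, and cancelling
    \<open>F\<close> leaves \<open>D\<close> as a divisor of the constant \<open>a\<close>.\<close>
  have "degree D = 0"
  proof (cases "F dvd D")
    case True
    then have "F dvd [:b:] * G" using b(2) by simp
    then have "F dvd [:b:]" using ndvd prime_elem_dvd_multD[OF F] by blast
    then have "degree F \<le> 0" using b(1) dvd_imp_degree_le[of F "[:b:]"] by simp
    then show ?thesis using min[OF FI] by simp
  next
    case False
    have "F dvd Polynomial.smult a F" by (rule dvd_smult) simp
    then have "F dvd D * Q" using a(2) by simp
    then have "F dvd Q" using False prime_elem_dvd_multD[OF F] by blast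
    then obtain Q' where Q': "Q = F * Q'" by (rule dvdE)
    have "F * [:a:] = F * (D * Q')" using a(2) unfolding Q' by (simp add: ac_simps)
    then have e: "D * Q' = [:a:]" using mult_left_cancel[OF \<open>F \<noteq> 0\<close>, of "[:a:]" "D * Q'"] by auto
    then have "D \<noteq> 0" "Q' \<noteq> 0" using a(1) by auto
    from degree_mult_eq[OF this] show ?thesis unfolding e by simp
  qed
  then obtain r where r: "D = [:r:]" by (rule degree_eq_zeroE)
  moreover obtain U V where "D = U * F + V * G" using D by (auto simp: I_def)
  ultimately show thesis using D0 by (intro that[of r U V]) auto
qed

text \<open>Coordinate \<open>l\<close> is exchanged with the outermost variable. Constants of the
  outer polynomial ring are then the polynomials free of that coordinate, and the constant found in
  the ideal of \<open>F\<close> and \<open>G\<close> vanishes at their common zeros.\<close>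

lemma eliminate_variable:
  fixes F G :: "'a::field_char_0 quadpoly"
  assumes F: "Factorial_Ring.irreducible F" and ndvd: "\<not> F dvd G" and l: "l < 4"
  obtains r where "r \<noteq> 0" "\<And>P. ev4 F P = 0 \<Longrightarrow> ev4 G P = 0 \<Longrightarrow> ev4 r P = 0"
    "\<And>P x. ev4 r (P(l := x)) = ev4 r P"
proof -
  define L where "L = (\<lambda>(P :: nat \<Rightarrow> 'a) i. P (transpose 0 l i))"
  have L: "polyfun (\<lambda>P. L P i)" if "i < 4" for i
    unfolding L_def using l that by (intro polyfun_proj) (auto simp: transpose_def)
  have LL: "L (L P) = P" for P by (simp add: L_def)
  define F' G' where "F' = precomp L F" and "G' = precomp L G"
  have "Factorial_Ring.irreducible F'"
    unfolding F'_def by (rule precomp_irreducible[OF L L LL LL F])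
  then have "prime_elem F'" by simp
  moreover have "\<not> F' dvd G'"
    unfolding F'_def G'_def using precomp_dvd_iff[OF L L LL LL] ndvd by simp
  ultimately obtain r U V where r: "r \<noteq> 0" "[:r:] = U * F' + V * G'"
    by (rule ideal_meets_constants)
  show thesis
  proof (rule that[of "precomp L [:r:]"])
    have "precomp L (precomp L [:r:]) = [:r:]"
      by (intro ev4_eq_imp) (simp add: ev4_precomp[OF L] LL)
    moreover have "precomp L 0 = 0" by (intro ev4_eq_imp) (simp add: ev4_precomp[OF L])
    ultimately show "precomp L [:r:] \<noteq> 0" using r(1) by auto
    show "ev4 (precomp L [:r:]) P = 0" if "ev4 F P = 0" "ev4 G P = 0" for P
      using that by (simp add: ev4_precomp[OF L] r(2) F'_def G'_def LL)
    show "ev4 (precomp L [:r:]) (P(l := x)) = ev4 (precomp L [:r:]) P" for P x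
    proof -
      \<comment> \<open>Changing coordinate \<open>l\<close> of \<open>P\<close> affects only
        coordinate 0 of \<open>L P\<close>, in which \<open>[:r:]\<close> is constant.\<close>
      have "L (P(l := x)) i = L P i" if "i \<noteq> 0" for i
        using that by (auto simp: L_def transpose_def)
      moreover have "ev4 (precomp L [:r:]) Q = ev4 [:r:] (L Q)" for Q
        by (simp add: ev4_precomp[OF L])
      moreover have "ev4 [:r:] (L (P(l := x))) = ev4 [:r:] (L P)"
        using calculation(1) by (simp add: ev4_def)
      ultimately show ?thesis by simp
    qed
  qed
qed

section \<open>Homogeneity\<close>

text \<open>\<open>h\<close> acts on the coefficients, so that nesting scales an iterated polynomial
  ring one variable at a time.\<close>

definition scale_by :: "('b \<Rightarrow> 'b) \<Rightarrow> 'b \<Rightarrow> 'b::comm_ring_1 poly \<Rightarrow> 'b poly" where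
  "scale_by h l p = pcompose (map_poly h p) [:0, l:]"

text \<open>In contrast to \<open>precomp\<close>, this substitution has explicit coefficients,
  which links scaling of points to degrees of monomials.\<close>

definition scale4 :: "'a::comm_ring_1 \<Rightarrow> 'a quadpoly \<Rightarrow> 'a quadpoly" where
  "scale4 l = scale_by (scale_by (scale_by (scale_by id l) [:l:]) [:[:l:]:]) [:[:[:l:]:]:]"

lemma scale_by_0 [simp]: "scale_by h l 0 = 0"
  by (simp add: scale_by_def)

lemma scale_by_pCons: "h 0 = 0 \<Longrightarrow> scale_by h l (pCons a p) = pCons (h a) (Polynomial.smult l (scale_by h l p))"
  by (cases "a = 0 \<and> p = 0") (auto simp: scale_by_def map_poly_pCons pcompose_pCons)

lemma coeff_scale_by: "h 0 = 0 \<Longrightarrow> coeff (scale_by h l p) i = l ^ i * h (coeff p i)"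
  by (simp add: scale_by_def coeff_pcompose_linear coeff_map_poly)

lemma coeff_scale4:
  "coeff (coeff (coeff (coeff (scale4 l p) i) j) k) m
    = l ^ (i + j + k + m) * coeff (coeff (coeff (coeff p i) j) k) m"
  by (simp add: scale4_def coeff_scale_by poly_const_pow power_add mult_ac)

lemma ev4_scale4: "ev4 (scale4 l p) P = ev4 p (\<lambda>i. l * P i)"
proof -
  define h1 where "h1 = scale_by id l"
  define h2 where "h2 = scale_by h1 [:l:]"
  define h3 where "h3 = scale_by h2 [:[:l:]:]"
  have z: "h1 0 = 0" "h2 0 = 0" "h3 0 = 0" by (simp_all add: h1_def h2_def h3_def)
  have 1: "poly (h1 p) x = poly p (l * x)" for p x
    unfolding h1_def by (induction p) (simp_all add: scale_by_pCons mult_ac)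
  have 2: "poly (poly (h2 p) [:y:]) x = poly (poly p [:l * y:]) (l * x)" for p x y
    unfolding h2_def by (induction p) (simp_all add: scale_by_pCons 1 z mult_ac)
  have 3: "poly (poly (poly (h3 p) [:[:u:]:]) [:y:]) x
      = poly (poly (poly p [:[:l * u:]:]) [:l * y:]) (l * x)" for p x y u
    unfolding h3_def by (induction p) (simp_all add: scale_by_pCons 2 z mult_ac)
  have "poly (poly (poly (poly (scale_by h3 [:[:[:l:]:]:] p) [:[:[:w:]:]:]) [:[:u:]:]) [:y:]) x
      = poly (poly (poly (poly p [:[:[:l * w:]:]:]) [:[:l * u:]:]) [:l * y:]) (l * x)" for p x y u w
    by (induction p) (simp_all add: scale_by_pCons 3 z mult_ac)
  then show ?thesis by (simp add: ev4_def scale4_def h1_def h2_def h3_def)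
qed

lemma quadpoly_eqI:
  assumes "\<And>i j k m. coeff (coeff (coeff (coeff p i) j) k) m = coeff (coeff (coeff (coeff q i) j) k) m"
  shows "p = q"
  by (intro poly_eqI assms)

lemma homogeneous4_ev4:
  assumes "homogeneous4 d p"
  shows "ev4 p (\<lambda>i. l * P i) = l ^ d * ev4 p P"
proof -
  have "scale4 l p = [:[:[:[:l ^ d:]:]:]:] * p"
  proof (rule quadpoly_eqI)
    fix i j k m
    show "coeff (coeff (coeff (coeff (scale4 l p) i) j) k) m
        = coeff (coeff (coeff (coeff ([:[:[:[:l ^ d:]:]:]:] * p) i) j) k) m"
      using assms by (cases "coeff (coeff (coeff (coeff p i) j) k) m = 0")
        (auto simp: coeff_scale4 homogeneous4_def)
  qed
  then have "ev4 (scale4 l p) P = l ^ d * ev4 p P" by (simp only: ev4_hom)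
  then show ?thesis by (simp add: ev4_scale4)
qed

text \<open>The single scaling factor 2 detects the degree, since in characteristic zero its powers are distinct.\<close>

lemma homogeneous4I:
  fixes p :: "'a::field_char_0 quadpoly"
  assumes "\<And>P. ev4 p (\<lambda>i. 2 * P i) = 2 ^ d * ev4 p P"
  shows "homogeneous4 d p"
  unfolding homogeneous4_def
proof (intro allI impI)
  fix i j k m assume nz: "coeff (coeff (coeff (coeff p i) j) k) m \<noteq> 0"
  have "scale4 2 p = [:[:[:[:2 ^ d:]:]:]:] * p"
    by (rule ev4_eq_imp) (simp only: ev4_scale4 assms ev4_hom)
  then have "2 ^ (i + j + k + m) * coeff (coeff (coeff (coeff p i) j) k) m
      = 2 ^ d * coeff (coeff (coeff (coeff p i) j) k) m"
    using coeff_scale4[of 2 p i j k m] by auto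
  then have "(of_nat (2 ^ (i + j + k + m)) :: 'a) = of_nat (2 ^ d)" using nz by auto
  then have "(2::nat) ^ (i + j + k + m) = 2 ^ d" by (simp only: of_nat_eq_iff)
  then show "i + j + k + m = d" by simp
qed

lemma homogeneous4_mult:
  fixes p q :: "'a::field_char_0 quadpoly"
  assumes "homogeneous4 d p" "homogeneous4 e q"
  shows "homogeneous4 (d + e) (p * q)"
  by (rule homogeneous4I) (simp add: homogeneous4_ev4[OF assms(1)] homogeneous4_ev4[OF assms(2)] power_add)

text \<open>The units are the nonzero constants, so scaling by 2 multiplies \<open>F\<close> by some
  constant. That constant equals 2 to the degree of every monomial of \<open>F\<close>, and in
  characteristic zero it determines this degree.\<close>

lemma homogeneous4_of_associated_scale:
  fixes F :: "'a::field_char_0 quadpoly"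
  assumes "F \<noteq> 0" "F dvd scale4 2 F" "scale4 2 F dvd F"
  shows "\<exists>d. homogeneous4 d F"
proof -
  obtain E where E: "scale4 2 F = F * E" using assms(2) by (elim dvdE)
  obtain E' where E': "F = scale4 2 F * E'" using assms(3) by (elim dvdE)
  have "F * 1 = F * (E * E')" using E E' by (simp add: mult.assoc)
  then have "E * E' = 1" using assms(1) mult_left_cancel[of F 1 "E * E'"] by metis
  then have "is_unit E" by (metis dvd_triv_left)
  then obtain e1 where e1: "E = [:e1:]" "is_unit e1" using is_unit_poly_iff by blast
  from e1(2) obtain e2 where e2: "e1 = [:e2:]" "is_unit e2" using is_unit_poly_iff by blast
  from e2(2) obtain e3 where e3: "e2 = [:e3:]" "is_unit e3" using is_unit_poly_iff by blast
  from e3(2) obtain c where "e3 = [:c:]" using is_unit_poly_iff by blast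
  then have c: "E = [:[:[:[:c:]:]:]:]" using e1 e2 e3 by simp
  have *: "2 ^ (i + j + k + m) = c" if "coeff (coeff (coeff (coeff F i) j) k) m \<noteq> 0" for i j k m
  proof -
    have "scale4 2 F = [:[:[:[:c:]:]:]:] * F" using E c by (simp only: mult.commute)
    then have "2 ^ (i + j + k + m) * coeff (coeff (coeff (coeff F i) j) k) m
      = c * coeff (coeff (coeff (coeff F i) j) k) m"
      using coeff_scale4[of 2 F i j k m] by auto
    then show ?thesis using that by simp
  qed
  obtain i j k m where nz: "coeff (coeff (coeff (coeff F i) j) k) m \<noteq> 0"
    using quadpoly_eqI[of F 0] assms(1) by auto
  have "homogeneous4 (i + j + k + m) F"
    unfolding homogeneous4_def
  proof (intro allI impI)
    fix i' j' k' m' assume "coeff (coeff (coeff (coeff F i') j') k') m' \<noteq> 0"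
    from *[OF this] *[OF nz] have "(2::'a) ^ (i' + j' + k' + m') = 2 ^ (i + j + k + m)" by simp
    then have "(of_nat (2 ^ (i' + j' + k' + m')) :: 'a) = of_nat (2 ^ (i + j + k + m))" by simp
    then have "(2::nat) ^ (i' + j' + k' + m') = 2 ^ (i + j + k + m)" by (simp only: of_nat_eq_iff)
    then show "i' + j' + k' + m' = i + j + k + m" by simp
  qed
  then show ?thesis by blast
qed

text \<open>Makes the results on forms in four variables available for binary forms.\<close>

lemma homogeneous2_iff: "homogeneous2 d p \<longleftrightarrow> homogeneous4 d (tv_to_R p)"
  unfolding homogeneous2_def homogeneous4_def tv_to_R_def
  by (auto simp: coeff_pCons split: nat.splits)

section \<open>Binary forms\<close>

text \<open>The univariate polynomial that \<open>Res_tv\<close> enters into the Sylvester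
  matrix.\<close>

definition dehom :: "'r::comm_ring_1 bipoly \<Rightarrow> 'r poly" where
  "dehom p = map_poly (\<lambda>c. poly c 1) p"

lemma homogeneous2_ev2:
  assumes "homogeneous2 d p"
  shows "ev2 p (l * t) (l * v) = l ^ d * ev2 p t v"
  using homogeneous4_ev4[OF assms[unfolded homogeneous2_iff], of l "\<lambda>i. if i = 2 then t else v"]
  by simp

lemma ev2_eq_poly_map: "ev2 p t v = poly (map_poly (\<lambda>c. poly c v) p) t"
  unfolding ev2_def by (induction p) (auto simp: map_poly_pCons)

lemma ev2_dehom: "ev2 p t 1 = poly (dehom p) t"
  by (simp add: ev2_eq_poly_map dehom_def)

lemma coeff_dehom: "coeff (dehom p) k = poly (coeff p k) 1"
  by (simp add: dehom_def coeff_map_poly)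

lemma homogeneous2_coeff:
  assumes "homogeneous2 d p"
  shows "coeff p k = (if k \<le> d then monom (coeff (dehom p) k) (d - k) else 0)"
proof (cases "k \<le> d")
  case True
  have "coeff p k = monom (coeff (coeff p k) (d - k)) (d - k)"
    using assms True by (intro poly_eqI) (force simp: homogeneous2_def coeff_monom)
  then show ?thesis using True by (metis coeff_dehom mult.right_neutral poly_monom power_one)
next
  case False
  have "coeff (coeff p k) j = 0" for j
  proof (rule ccontr)
    assume "coeff (coeff p k) j \<noteq> 0"
    then have "k + j = d" using assms unfolding homogeneous2_def by blast
    then show False using False by simp
  qed
  then show ?thesis using False by (simp add: poly_eq_iff)
qed

lemma degree_dehom_le: "homogeneous2 d p \<Longrightarrow> degree (dehom p) \<le> d"
  by (rule degree_le) (simp add: coeff_dehom homogeneous2_coeff[of d p])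

lemma ev2_expand:
  assumes "homogeneous2 d p"
  shows "ev2 p t v = (\<Sum>k\<le>d. coeff (dehom p) k * t ^ k * v ^ (d - k))"
proof -
  let ?q = "map_poly (\<lambda>c. poly c v) p"
  have "degree ?q \<le> d"
    by (rule degree_le) (simp add: coeff_map_poly homogeneous2_coeff[OF assms])
  then have "ev2 p t v = (\<Sum>k\<le>d. coeff ?q k * t ^ k)"
    unfolding ev2_eq_poly_map unfolding poly_altdef
    by (intro sum.mono_neutral_left) (auto simp: coeff_eq_0)
  also have "\<dots> = (\<Sum>k\<le>d. coeff (dehom p) k * t ^ k * v ^ (d - k))"
    by (rule sum.cong) (auto simp: coeff_map_poly homogeneous2_coeff[OF assms] poly_monom mult_ac)
  finally show ?thesis .
qed

lemma ev2_eq_0_imp: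
  fixes p :: "'a::field_char_0 bipoly"
  assumes "\<And>t v. ev2 p t v = 0"
  shows "p = 0"
proof -
  have "tv_to_R p = 0" by (rule ev4_eq_0_imp) (simp add: assms)
  then show ?thesis by (simp add: tv_to_R_def)
qed

text \<open>At infinity only the coefficient of index \<open>d\<close> is seen; it is zero when the
  degree drops under dehomogenisation.\<close>

lemma ev2_infinity:
  assumes "homogeneous2 d p"
  shows "ev2 p t 0 = coeff (dehom p) d * t ^ d"
proof -
  have "ev2 p t 0 = (\<Sum>k\<le>d. if k = d then coeff (dehom p) d * t ^ d else 0)"
    unfolding ev2_expand[OF assms] by (rule sum.cong) (auto simp: power_0_left)
  then show ?thesis by simp
qed

lemma dehom_eq_0_imp:
  fixes p :: "'a::field_char_0 bipoly"
  assumes "homogeneous2 d p" "dehom p = 0"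
  shows "p = 0"
  by (rule ev2_eq_0_imp) (simp add: ev2_expand[OF assms(1)] assms(2))

text \<open>A nonconstant dehomogenised polynomial has a root. A constant one has coefficient 0 at
  index \<open>d\<close>, which is at least 1, so the form vanishes at infinity.\<close>

lemma exists_binary_zero:
  fixes p :: "'a::alg_closed_field bipoly"
  assumes "homogeneous2 d p" "d \<ge> 1"
  obtains t v where "(t, v) \<noteq> (0, 0)" "ev2 p t v = 0"
proof (cases "degree (dehom p) = 0")
  case True
  then have "ev2 p 1 0 = 0" using assms by (simp add: ev2_infinity coeff_eq_0)
  then show ?thesis using that[of 1 0] by simp
next
  case False
  then obtain x where "poly (dehom p) x = 0" using alg_closed_imp_poly_has_root by blast
  then show ?thesis using that[of x 1] by (simp add: ev2_dehom)
qed

text \<open>With outer variable T and inner variable V the linear form is v T - t V. For nonzero v,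
  substituting (t/v) V for T kills \<open>p\<close>; for v = 0 the pure power of T is missing from
  \<open>p\<close>, so V divides every coefficient.\<close>

lemma linear_form_dvd:
  fixes p :: "'a::field_char_0 bipoly"
  assumes p: "homogeneous2 d p" and z: "ev2 p t v = 0" "(t, v) \<noteq> (0, 0)"
  shows "[:[:0, - t:], [:v:]:] dvd p"
proof (cases "v = 0")
  case False
  define c where "c = t / v"
  have 1: "poly (poly q [:0, c:]) y = ev2 q (c * y) y" for q y
    unfolding ev2_def by (induction q) (auto simp: mult_ac)
  have "v * c = t" using False by (simp add: c_def)
  then have "ev2 p c 1 = 0"
    using homogeneous2_ev2[OF p, of v c 1] z(1) False by simp
  \<comment> \<open>Homogeneity spreads the zero at \<open>(c, 1)\<close> over the whole line of
    points \<open>(c * y, y)\<close>.\<close>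
  then have "poly (poly p [:0, c:]) y = 0" for y
    using homogeneous2_ev2[OF p, of y c 1] unfolding 1 by (simp add: mult.commute)
  then have "poly p [:0, c:] = 0" using poly_all_0_iff_0 by blast
  then have "[:- [:0, c:], 1:] dvd p" by (simp add: poly_eq_0_iff_dvd)
  moreover have "[:[:0, - t:], [:v:]:] * [:[:1 / v:]:] = [:- [:0, c:], 1:]"
    using False by (simp add: c_def)
  ultimately have "[:[:0, - t:], [:v:]:] * [:[:1 / v:]:] dvd p" by (simp only:)
  then show ?thesis by (rule dvd_mult_left)
next
  case True
  then have "t \<noteq> 0" using z by simp
  have 0: "coeff (coeff p i) 0 = 0" for i
  proof -
    have "coeff (dehom p) d = 0"
      using z(1) True \<open>t \<noteq> 0\<close> by (simp add: ev2_infinity[OF p])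
    then show ?thesis by (subst homogeneous2_coeff[OF p]) (auto simp: coeff_monom)
  qed
  have "[:0, - t:] dvd coeff p i" for i
  proof -
    have "[:0, 1:] dvd coeff p i"
      using 0[of i] poly_eq_0_iff_dvd[of "coeff p i" 0] by (simp add: poly_0_coeff_0)
    moreover have "[:0, - t:] * [:- 1 / t:] = [:0, 1:]" using \<open>t \<noteq> 0\<close> by simp
    ultimately have "[:0, - t:] * [:- 1 / t:] dvd coeff p i" by (simp only:)
    then show ?thesis by (rule dvd_mult_left)
  qed
  then show ?thesis using True by (simp add: const_poly_dvd_iff)
qed

lemma linear_form_not_unit:
  fixes t v :: "'a::field"
  assumes "(t, v) \<noteq> (0, 0)"
  shows "\<not> is_unit [:[:0, - t:], [:v:]:]"
  using assms by (auto simp: is_unit_poly_iff)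

section \<open>The homogeneous resultant\<close>

text \<open>The vector of all monomials of degree d + e - 1, evaluated at the common zero, lies in
  the kernel: each row yields a monomial times the value of \<open>p\<close> or of \<open>q\<close>.
  The condition on d + e excludes the empty determinant 1.\<close>

lemma Res_tv_eq_0:
  fixes p q :: "'r::idom bipoly"
  assumes p: "homogeneous2 d p" and q: "homogeneous2 e q"
    and z: "ev2 p t v = 0" "ev2 q t v = 0" "(t, v) \<noteq> (0, 0)" and de: "d + e > 0"
  shows "Res_tv d e p q = 0"
proof -
  let ?N = "d + e"
  let ?M = "sylvester_mat_sub d e (dehom p) (dehom q)"
  define x where "x = vec ?N (\<lambda>j. t ^ (?N - 1 - j) * v ^ j)"
  have x: "x \<in> carrier_vec ?N" by (simp add: x_def)
  have x0: "x \<noteq> 0\<^sub>v ?N"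
  proof
    assume "x = 0\<^sub>v ?N"
    \<comment> \<open>The first and last entries are pure powers of \<open>t\<close> and
      \<open>v\<close>; for d + e = 1 they coincide and equal 1.\<close>
    then have "x $ 0 = 0" "x $ (?N - 1) = 0" using de by auto
    then have "t ^ (?N - 1) = 0" "v ^ (?N - 1) = 0 \<or> ?N = 1 \<and> t ^ (?N - 1) = 0" using de by (auto simp: x_def)
    then have "t = 0 \<and> (v = 0 \<or> ?N = 1)" by auto
    then show False using z(3) \<open>t ^ (?N - 1) = 0\<close> by auto
  qed
  have "?M *\<^sub>v x = 0\<^sub>v ?N"
  proof (rule eq_vecI)
    fix i assume i: "i < dim_vec (0\<^sub>v ?N :: 'r vec)"
    then have iN: "i < ?N" by simp
    have row: "(?M *\<^sub>v x) $ i = (\<Sum>j<?N. ?M $$ (i, j) * (t ^ (?N - 1 - j) * v ^ j))"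
      using iN by (simp add: scalar_prod_def x_def lessThan_atLeast0)
    show "(?M *\<^sub>v x) $ i = 0\<^sub>v ?N $ i"
    proof (cases "i < e")
      case True
      have "(\<Sum>j<?N. ?M $$ (i, j) * (t ^ (?N - 1 - j) * v ^ j))
          = (\<Sum>j\<in>{i..i + d}. coeff (dehom p) (d + i - j) * (t ^ (?N - 1 - j) * v ^ j))"
        using True by (intro sum.mono_neutral_cong_right) (auto simp: sylvester_mat_sub_index)
      \<comment> \<open>Reindexing by the exponent of \<open>t\<close> in \<open>p\<close> pulls the
        shift monomial of row \<open>i\<close> out of the sum.\<close>
      also have "\<dots> = (\<Sum>k\<le>d. t ^ (e - 1 - i) * v ^ i * (coeff (dehom p) k * t ^ k * v ^ (d - k)))"
      proof (rule sum.reindex_bij_witness[of _ "\<lambda>k. d + i - k" "\<lambda>j. d + i - j"])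
        fix j assume j: "j \<in> {i..i + d}"
        then have "?N - 1 - j = (e - 1 - i) + (d + i - j)" "j = i + (d - (d + i - j))"
          using True by auto
        then have "t ^ (?N - 1 - j) = t ^ (e - 1 - i) * t ^ (d + i - j)" "v ^ j = v ^ i * v ^ (d - (d + i - j))"
          by (simp_all flip: power_add)
        then show "t ^ (e - 1 - i) * v ^ i * (coeff (dehom p) (d + i - j) * t ^ (d + i - j) * v ^ (d - (d + i - j)))
            = coeff (dehom p) (d + i - j) * (t ^ (?N - 1 - j) * v ^ j)"
          by (simp only: mult_ac)
      qed auto
      also have "\<dots> = t ^ (e - 1 - i) * v ^ i * ev2 p t v"
        unfolding ev2_expand[OF p] sum_distrib_left ..
      finally show ?thesis using row z iN by simp
    next
      case False
      define i' where "i' = i - e"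
      have ie: "i = e + i'" "i' < d" using False iN by (auto simp: i'_def)
      have "(\<Sum>j<?N. ?M $$ (i, j) * (t ^ (?N - 1 - j) * v ^ j))
          = (\<Sum>j\<in>{i'..i' + e}. coeff (dehom q) (e + i' - j) * (t ^ (?N - 1 - j) * v ^ j))"
        using ie by (intro sum.mono_neutral_cong_right) (auto simp: sylvester_mat_sub_index)
      also have "\<dots> = (\<Sum>k\<le>e. t ^ (d - 1 - i') * v ^ i' * (coeff (dehom q) k * t ^ k * v ^ (e - k)))"
      proof (rule sum.reindex_bij_witness[of _ "\<lambda>k. e + i' - k" "\<lambda>j. e + i' - j"])
        fix j assume j: "j \<in> {i'..i' + e}"
        then have "?N - 1 - j = (d - 1 - i') + (e + i' - j)" "j = i' + (e - (e + i' - j))"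
          using ie by auto
        then have "t ^ (?N - 1 - j) = t ^ (d - 1 - i') * t ^ (e + i' - j)" "v ^ j = v ^ i' * v ^ (e - (e + i' - j))"
          by (simp_all flip: power_add)
        then show "t ^ (d - 1 - i') * v ^ i' * (coeff (dehom q) (e + i' - j) * t ^ (e + i' - j) * v ^ (e - (e + i' - j)))
            = coeff (dehom q) (e + i' - j) * (t ^ (?N - 1 - j) * v ^ j)"
          by (simp only: mult_ac)
      qed auto
      also have "\<dots> = t ^ (d - 1 - i') * v ^ i' * ev2 q t v"
        unfolding ev2_expand[OF q] sum_distrib_left ..
      finally show ?thesis using row z iN by simp
    qed
  qed auto
  then have "det ?M = 0"
    using det_0_iff_vec_prod_zero[OF sylvester_mat_sub_carrier] x x0 by blast
  then show ?thesis by (simp add: Res_tv_def dehom_def)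
qed

text \<open>The linear factors of \<open>p\<close> are moved into \<open>V\<close> one at a time: at
  a root of \<open>p\<close> the polynomial \<open>q\<close> is nonzero, so \<open>V\<close> has
  that root.\<close>

lemma dvd_of_dvd_mult_no_common_root:
  fixes p q V :: "'a::alg_closed_field poly"
  assumes "p dvd V * q" "p \<noteq> 0" "\<And>x. poly p x = 0 \<Longrightarrow> poly q x \<noteq> 0"
  shows "p dvd V"
  using assms
proof (induction "degree p" arbitrary: p V)
  case 0
  then obtain c where "p = [:c:]" by (metis degree_eq_zeroE)
  then show ?case using 0 by (simp add: const_poly_dvd_iff dvd_field_iff)
next
  case (Suc n)
  then obtain a where a: "poly p a = 0" using alg_closed_imp_poly_has_root by (metis zero_less_Suc)
  then obtain p' where p': "p = [:-a, 1:] * p'" by (auto simp: poly_eq_0_iff_dvd elim: dvdE)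
  obtain k where k: "V * q = p * k" using Suc.prems(1) by (elim dvdE)
  have "poly (V * q) a = 0" unfolding k using a by simp
  then have "poly V a = 0" using Suc.prems(3)[OF a] by simp
  then obtain V' where V': "V = [:-a, 1:] * V'" by (auto simp: poly_eq_0_iff_dvd elim: dvdE)
  have "p' \<noteq> 0" using Suc.prems(2) p' by auto
  then have "degree p = Suc (degree p')" unfolding p' by (subst degree_mult_eq) auto
  then have "n = degree p'" using Suc.hyps(2) by simp
  moreover have "p' dvd V' * q"
  proof -
    have "[:-a, 1:] * p' dvd [:-a, 1:] * (V' * q)"
      using Suc.prems(1) unfolding p' V' by (simp only: mult.assoc)
    then show ?thesis by (subst (asm) dvd_mult_cancel_left) auto
  qed
  moreover have "poly q x \<noteq> 0" if "poly p' x = 0" for x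
    using Suc.prems(3)[of x] that unfolding p' by simp
  ultimately have "p' dvd V'" using Suc.hyps(1) \<open>p' \<noteq> 0\<close> by blast
  then show ?case unfolding p' V' by (rule mult_dvd_mono[OF dvd_refl])
qed

text \<open>A kernel vector of the transpose encodes a relation U p + V q = 0 with deg U < e and deg
  V < d. Without common roots \<open>p\<close> divides \<open>V\<close>, and its full degree
  \<open>d\<close> forces V = 0, hence U = 0.\<close>

lemma det_sylvester_nonzero:
  fixes p q :: "'a::alg_closed_field poly"
  assumes dp: "degree p \<le> d" "coeff p d \<noteq> 0" and dq: "degree q \<le> e"
    and nr: "\<And>x. poly p x = 0 \<Longrightarrow> poly q x \<noteq> 0"
  shows "det (sylvester_mat_sub d e p q) \<noteq> 0"
proof
  let ?N = "d + e" and ?M = "sylvester_mat_sub d e p q"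
  assume "det ?M = 0"
  then have "det (transpose_mat ?M) = 0"
    by (subst det_transpose[OF sylvester_mat_sub_carrier])
  moreover have "transpose_mat ?M \<in> carrier_mat ?N ?N"
    using sylvester_mat_sub_carrier by (rule transpose_carrier_mat[THEN iffD2])
  ultimately obtain x where x: "x \<in> carrier_vec ?N" "x \<noteq> 0\<^sub>v ?N" and Mx: "transpose_mat ?M *\<^sub>v x = 0\<^sub>v ?N"
    using det_0_iff_vec_prod_zero by blast
  \<comment> \<open>The first \<open>e\<close> entries belong to the rows of \<open>p\<close>, the
    last \<open>d\<close> to those of \<open>q\<close>; rows run from the highest shift
    downwards.\<close>
  define U where "U = (\<Sum>i<e. monom (x $ i) (e - 1 - i))"
  define V where "V = (\<Sum>i<d. monom (x $ (e + i)) (d - 1 - i))"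
  have cU: "coeff U k = (if k < e then x $ (e - 1 - k) else 0)" for k
  proof -
    have "coeff U k = (\<Sum>i<e. if i = e - 1 - k \<and> k < e then x $ i else 0)"
      unfolding U_def coeff_sum by (rule sum.cong) (auto simp: coeff_monom)
    then show ?thesis by (auto simp: if_distrib cong: if_cong)
  qed
  have cV: "coeff V k = (if k < d then x $ (e + (d - 1 - k)) else 0)" for k
  proof -
    have "coeff V k = (\<Sum>i<d. if i = d - 1 - k \<and> k < d then x $ (e + i) else 0)"
      unfolding V_def coeff_sum by (rule sum.cong) (auto simp: coeff_monom)
    then show ?thesis by (auto simp: if_distrib cong: if_cong)
  qed
  have split: "(\<Sum>i<e + d'. f i) = (\<Sum>i<e. f i) + (\<Sum>i<d'. f (e + i))" for f :: "nat \<Rightarrow> 'a" and d'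
    by (induction d') (simp_all add: add.assoc)
  have UV: "U * p + V * q = 0"
  proof (rule poly_eqI)
    fix k
    show "coeff (U * p + V * q) k = coeff 0 k"
    proof (cases "k < ?N")
      case True
      define j where "j = ?N - 1 - k"
      have j: "j < ?N" "k = ?N - 1 - j" using True by (auto simp: j_def)
      have "0 = (transpose_mat ?M *\<^sub>v x) $ j" using Mx j by simp
      also have "\<dots> = (\<Sum>i<e + d. ?M $$ (i, j) * x $ i)"
        using j x by (simp add: scalar_prod_def lessThan_atLeast0 add.commute)
      also have "\<dots> = (\<Sum>i<e. ?M $$ (i, j) * x $ i) + (\<Sum>i<d. ?M $$ (e + i, j) * x $ (e + i))"
        by (rule split)
      also have "(\<Sum>i<e. ?M $$ (i, j) * x $ i) = coeff (U * p) k"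
        unfolding U_def sum_distrib_right coeff_sum
      proof (rule sum.cong)
        fix i assume "i \<in> {..<e}"
        then show "?M $$ (i, j) * x $ i = coeff (monom (x $ i) (e - 1 - i) * p) k"
          using j dp by (auto simp: sylvester_mat_sub_index coeff_monom_mult coeff_eq_0 
              intro!: arg_cong[of _ _ "coeff p"])
      qed simp
      also have "(\<Sum>i<d. ?M $$ (e + i, j) * x $ (e + i)) = coeff (V * q) k"
        unfolding V_def sum_distrib_right coeff_sum
      proof (rule sum.cong)
        fix i assume "i \<in> {..<d}"
        then show "?M $$ (e + i, j) * x $ (e + i) = coeff (monom (x $ (e + i)) (d - 1 - i) * q) k"
          using j dq by (auto simp: sylvester_mat_sub_index coeff_monom_mult coeff_eq_0 
              intro!: arg_cong[of _ _ "coeff q"])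
      qed simp
      finally show ?thesis by simp
    next
      case False
      have "coeff (U * p) k = 0"
        unfolding coeff_mult using False dp
        by (intro sum.neutral) (auto simp: cU coeff_eq_0)
      moreover have "coeff (V * q) k = 0"
        unfolding coeff_mult using False dq
        by (intro sum.neutral) (auto simp: cV coeff_eq_0)
      ultimately show ?thesis by simp
    qed
  qed
  have "p \<noteq> 0" using dp by auto
  have "V * q = p * (- U)" using UV by (simp add: add_eq_0_iff mult.commute)
  then have "p dvd V" using dvd_of_dvd_mult_no_common_root[of p V q] \<open>p \<noteq> 0\<close> nr by simp
  have "V = 0"
  proof (rule ccontr)
    assume "V \<noteq> 0"
    then have "degree p \<le> degree V" using \<open>p dvd V\<close> by (simp add: dvd_imp_degree_le)
    moreover have "degree p = d" using dp le_degree by force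
    moreover have "coeff V (degree V) \<noteq> 0" using \<open>V \<noteq> 0\<close> by simp
    then have "degree V < d" by (auto simp: cV split: if_splits)
    ultimately show False by simp
  qed
  then have "U = 0" using UV \<open>p \<noteq> 0\<close> by simp
  have "x $ i = 0" if "i < ?N" for i
  proof (cases "i < e")
    case True
    then show ?thesis using cU[of "e - 1 - i"] \<open>U = 0\<close> by simp
  next
    case False
    then show ?thesis using cV[of "d - 1 - (i - e)"] \<open>V = 0\<close> that by (simp split: if_splits)
  qed
  then show False using x by auto
qed

section \<open>Closed subsets of projective space\<close>

lemma eval4_smult_vec:
  assumes "homogeneous4 d F" "q \<in> carrier_vec 4"
  shows "eval4 F (c \<cdot>\<^sub>v q) = c ^ d * eval4 F q"
proof -
  have "eval4 F (c \<cdot>\<^sub>v q) = ev4 F (\<lambda>i. c * q $ i)"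
    unfolding eval4_eq_ev4 using assms(2) by (intro ev4_cong) simp
  then show ?thesis by (simp add: homogeneous4_ev4[OF assms(1)] eval4_eq_ev4)
qed

lemma eval4_vec: "eval4 F (vec 4 P) = ev4 F P"
  unfolding eval4_eq_ev4 by (intro ev4_cong) simp

lemma proj_point_self: "q \<in> proj_point (q :: 'a::field vec)"
  unfolding proj_point_def by (auto intro!: exI[of _ 1])

lemma proj_point_smult:
  fixes q :: "'a::field vec"
  assumes "c \<noteq> 0"
  shows "proj_point (c \<cdot>\<^sub>v q) = proj_point q"
proof -
  have "\<exists>e. x = e \<cdot>\<^sub>v (c \<cdot>\<^sub>v q) \<and> e \<noteq> 0" if "x = b \<cdot>\<^sub>v q" "b \<noteq> 0" for x b
    using that assms by (intro exI[of _ "b / c"]) (simp add: smult_smult_assoc)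
  moreover have "\<exists>e. x = e \<cdot>\<^sub>v q \<and> e \<noteq> 0" if "x = b \<cdot>\<^sub>v (c \<cdot>\<^sub>v q)" "b \<noteq> 0" for x b
    using that assms by (intro exI[of _ "b * c"]) (simp add: smult_smult_assoc)
  ultimately show ?thesis unfolding proj_point_def by blast
qed

text \<open>Homogeneity makes vanishing independent of the representative of the point.\<close>

lemma proj_point_in_zeros_iff:
  fixes q :: "'a::field vec"
  assumes "q \<in> carrier_vec 4" "q \<noteq> 0\<^sub>v 4" "\<forall>F\<in>S. \<exists>d. homogeneous4 d F"
  shows "proj_point q \<in> proj_zeros S \<longleftrightarrow> (\<forall>F\<in>S. eval4 F q = 0)"
proof
  assume "proj_point q \<in> proj_zeros S"
  then obtain p where p: "p \<in> carrier_vec 4" "proj_point q = proj_point p" "\<forall>F\<in>S. eval4 F p = 0"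
    by (auto simp: proj_zeros_def)
  have "q \<in> proj_point p" using proj_point_self[of q] p(2) by simp
  then obtain c where "q = c \<cdot>\<^sub>v p" by (auto simp: proj_point_def)
  then show "\<forall>F\<in>S. eval4 F q = 0"
    using p(1,3) assms(3) eval4_smult_vec by fastforce
next
  assume "\<forall>F\<in>S. eval4 F q = 0"
  then show "proj_point q \<in> proj_zeros S" using assms by (auto simp: proj_zeros_def)
qed

lemma homogeneous4_1: "homogeneous4 0 (1 :: 'a::field_char_0 quadpoly)"
  by (rule homogeneous4I) simp

lemma zariski_closed_empty: "zariski_closed ({} :: 'a::field_char_0 vec set set)"
proof -
  have "{} = proj_zeros {1 :: 'a quadpoly}"
    by (auto simp: proj_zeros_def eval4_eq_ev4)
  then show ?thesis unfolding zariski_closed_def using homogeneous4_1 by blast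
qed

text \<open>The union is cut out by the products of a form from each side.\<close>

lemma zariski_closed_Un:
  fixes Y Z :: "'a::field_char_0 vec set set"
  assumes "zariski_closed Y" "zariski_closed Z"
  shows "zariski_closed (Y \<union> Z)"
proof -
  obtain S T where S: "\<forall>F\<in>S. \<exists>d. homogeneous4 d F" "Y = proj_zeros S"
    and T: "\<forall>F\<in>T. \<exists>d. homogeneous4 d F" "Z = proj_zeros T"
    using assms by (auto simp: zariski_closed_def)
  define ST where "ST = {F * G | F G. F \<in> S \<and> G \<in> T}"
  have e: "(\<forall>H\<in>ST. eval4 H p = 0) \<longleftrightarrow> (\<forall>F\<in>S. eval4 F p = 0) \<or> (\<forall>F\<in>T. eval4 F p = 0)" for p
  proof
    assume l: "\<forall>H\<in>ST. eval4 H p = 0"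
    have "eval4 F p = 0 \<or> eval4 G p = 0" if "F \<in> S" "G \<in> T" for F G
    proof -
      have "F * G \<in> ST" using that unfolding ST_def by blast
      then have "eval4 (F * G) p = 0" using l by blast
      then show ?thesis by (simp add: eval4_eq_ev4)
    qed
    then show "(\<forall>F\<in>S. eval4 F p = 0) \<or> (\<forall>F\<in>T. eval4 F p = 0)" by blast
  next
    assume r: "(\<forall>F\<in>S. eval4 F p = 0) \<or> (\<forall>F\<in>T. eval4 F p = 0)"
    show "\<forall>H\<in>ST. eval4 H p = 0"
    proof
      fix H assume "H \<in> ST"
      then obtain F G where "H = F * G" "F \<in> S" "G \<in> T" unfolding ST_def by blast
      then show "eval4 H p = 0" using r by (auto simp: eval4_eq_ev4)
    qed
  qed
  have "Y \<union> Z = proj_zeros ST"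
    unfolding S T proj_zeros_def e by blast
  moreover have "\<forall>H\<in>ST. \<exists>d. homogeneous4 d H"
    using S T homogeneous4_mult unfolding ST_def by blast
  ultimately show ?thesis unfolding zariski_closed_def by blast
qed

lemma ev4_wxyz [simp]: "i < 4 \<Longrightarrow> ev4 (wxyz $ i) P = P i"
proof -
  assume "i < 4"
  then consider "i = 0" | "i = 1" | "i = 2" | "i = 3" by linarith
  then show ?thesis by cases (simp_all add: wxyz_def ev4_def numeral_2_eq_2 numeral_3_eq_3)
qed

lemma zariski_closed_linear:
  fixes c :: "'i \<Rightarrow> nat \<Rightarrow> 'a::field_char_0"
  shows "zariski_closed {proj_point p | p. p \<in> carrier_vec 4 \<and> p \<noteq> 0\<^sub>v 4 \<and> (\<forall>r\<in>I. (\<Sum>i<4. c r i * p $ i) = 0)}"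
proof -
  define L where "L r = (\<Sum>i<4. [:[:[:[:c r i:]:]:]:] * wxyz $ i)" for r
  have ev: "ev4 (L r) P = (\<Sum>i<4. c r i * P i)" for r P
    unfolding L_def by (simp only: ev4_sum ev4_hom) (simp add: ev4_wxyz)
  have "homogeneous4 1 (L r)" for r
    by (rule homogeneous4I) (simp add: ev sum_distrib_left mult_ac)
  then have "\<forall>F\<in>L ` I. \<exists>d. homogeneous4 d F" by blast
  then show ?thesis unfolding zariski_closed_def
    by (intro exI[of _ "L ` I"]) (simp add: proj_zeros_def eval4_eq_ev4 ev)
qed

text \<open>A point is cut out by the 2 by 2 minors against a fixed nonzero coordinate
  \<open>k\<close> of \<open>q\<close>.\<close>

lemma zariski_closed_point:
  fixes q :: "'a::field_char_0 vec"
  assumes q: "q \<in> carrier_vec 4" "q \<noteq> 0\<^sub>v 4"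
  shows "zariski_closed {proj_point q}"
proof -
  obtain k where k: "k < 4" "q $ k \<noteq> 0" using q by (metis eq_vecI carrier_vecD index_zero_vec)
  \<comment> \<open>Two conditionals are added, rather than nested, so that the case r = k gives the
    zero form.\<close>
  define c where "c r i = (if i = k then - q $ r else 0) + (if i = r then q $ k else 0)" for r i :: nat
  have c: "(\<Sum>i<4. c r i * p $ i) = q $ k * p $ r - q $ r * p $ k" if "r < 4" for r and p :: "'a vec"
    using that k(1) by (simp add: c_def ring_distribs sum.distrib if_distrib[of "\<lambda>x. x * _"] cong: if_cong)
  have "p = (p $ k / q $ k) \<cdot>\<^sub>v q \<and> p $ k \<noteq> 0"
    if p: "p \<in> carrier_vec 4" "p \<noteq> 0\<^sub>v 4" "\<forall>r\<in>{..<4}. (\<Sum>i<4. c r i * p $ i) = 0" for p :: "'a vec"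
  proof -
    have e: "p = (p $ k / q $ k) \<cdot>\<^sub>v q"
    proof (rule eq_vecI)
      fix r assume "r < dim_vec ((p $ k / q $ k) \<cdot>\<^sub>v q)"
      then have "r < 4" using q by simp
      then have "q $ k * p $ r = q $ r * p $ k" using p(3) c by simp
      then show "p $ r = ((p $ k / q $ k) \<cdot>\<^sub>v q) $ r" using k \<open>r < 4\<close> q by (simp add: field_simps)
    qed (use p q in auto)
    moreover have "p $ k \<noteq> 0"
    proof
      assume "p $ k = 0"
      then have "p $ r = 0" if "r < 4" for r using that q by (subst e) simp
      then show False using p by (metis eq_vecI carrier_vecD index_zero_vec)
    qed
    ultimately show ?thesis by blast
  qed
  then have 1: "proj_point p = proj_point q"
    if "p \<in> carrier_vec 4" "p \<noteq> 0\<^sub>v 4" "\<forall>r\<in>{..<4}. (\<Sum>i<4. c r i * p $ i) = 0" for p :: "'a vec"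
    using that proj_point_smult[of "p $ k / q $ k" q] k(2) by (metis divide_eq_0_iff)
  have 2: "\<forall>r\<in>{..<4}. (\<Sum>i<4. c r i * q $ i) = 0" using c by simp
  have "{proj_point q} = {proj_point p | p. p \<in> carrier_vec 4 \<and> p \<noteq> 0\<^sub>v 4 \<and> (\<forall>r\<in>{..<4}. (\<Sum>i<4. c r i * p $ i) = 0)}"
    using 1 2 q by blast
  then show ?thesis using zariski_closed_linear[where I = "{..<4}" and c = c] by (simp only:)
qed

lemma zariski_closed_finite:
  fixes Z :: "'a::field_char_0 vec set set"
  assumes "finite Z" "\<And>z. z \<in> Z \<Longrightarrow> \<exists>q \<in> carrier_vec 4. q \<noteq> 0\<^sub>v 4 \<and> z = proj_point q"
  shows "zariski_closed Z"
  using assms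
proof (induction Z rule: finite_induct)
  case empty
  then show ?case by (simp add: zariski_closed_empty)
next
  case (insert z Z)
  then obtain q where "q \<in> carrier_vec 4" "q \<noteq> 0\<^sub>v 4" "z = proj_point q" by blast
  then have "zariski_closed {z}" using zariski_closed_point by blast
  moreover have "zariski_closed Z" using insert by blast
  ultimately show ?case using zariski_closed_Un[of "{z}" Z] by simp
qed

section \<open>Dimension of subsets of a line\<close>

lemma ev4_along_line:
  fixes F :: "'a::field_char_0 quadpoly"
  obtains h where "\<And>x. poly h x = ev4 F (\<lambda>i. u i + x * w i)"
proof -
  \<comment> \<open>The innermost coordinate serves as parameter of the line; the three outer
    variables are later set to 0.\<close>
  have "polyfun (\<lambda>P. ev4 F (\<lambda>i. u i + P 3 * w i))"
    by (intro polyfun_compose polyfun_add polyfun_mult polyfun_const polyfun_proj) simp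
  then obtain p where p: "\<And>P. ev4 F (\<lambda>i. u i + P 3 * w i) = ev4 p P" by (auto simp: polyfun_def)
  show thesis
  proof (rule that[of "poly (poly (poly p [:[:[:0:]:]:]) [:[:0:]:]) [:0:]"])
    show "poly (poly (poly (poly p [:[:[:0:]:]:]) [:[:0:]:]) [:0:]) x = ev4 F (\<lambda>i. u i + x * w i)" for x
      using p[of "\<lambda>i. if i = 3 then x else 0"] by (simp add: ev4_def)
  qed
qed

text \<open>A form that is nonzero somewhere on a line has finitely many zeros there. In a chain of
  length 2 the middle member is thus finite and, being irreducible, a single point, which leaves no
  room for a nonempty member below it.\<close>

lemma zariski_dim_line:
  fixes Y :: "'a::field_char_0 vec set set" and u w :: "nat \<Rightarrow> 'a"
  assumes Y: "\<And>y. y \<in> Y \<Longrightarrow> \<exists>a b. vec 4 (\<lambda>i. a * u i + b * w i) \<noteq> 0\<^sub>v 4 \<and> y = proj_point (vec 4 (\<lambda>i. a * u i + b * w i))"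
  shows "zariski_dim Y \<noteq> 2"
proof
  let ?pt = "\<lambda>a b. vec 4 (\<lambda>i. a * u i + b * w i)"
  assume dim: "zariski_dim Y = 2"
  have "\<exists>d Z. 2 \<le> d \<and> (\<forall>i\<le>d. irreducible_closed (Z i) \<and> Z i \<subseteq> Y) \<and> (\<forall>i<d. Z i \<subset> Z (Suc i))"
  proof (rule ccontr)
    assume no: "\<not> ?thesis"
    have "zariski_dim Y \<le> 1"
      unfolding zariski_dim_def
    proof (rule Sup_least)
      fix x :: enat assume "x \<in> {enat d | d. \<exists>Z. (\<forall>i\<le>d. irreducible_closed (Z i) \<and> Z i \<subseteq> Y) \<and> (\<forall>i<d. Z i \<subset> Z (Suc i))}"
      then obtain d where "x = enat d" "\<not> 2 \<le> d" using no by blast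
      then show "x \<le> 1" by (simp add: one_enat_def)
    qed
    then show False using dim by (simp add: one_enat_def numeral_eq_enat)
  qed
  then obtain d and Z :: "nat \<Rightarrow> 'a vec set set" where d: "2 \<le> d" and Z: "\<And>i. i \<le> d \<Longrightarrow> irreducible_closed (Z i)" "\<And>i. i \<le> d \<Longrightarrow> Z i \<subseteq> Y"
    and chain: "\<And>i. i < d \<Longrightarrow> Z i \<subset> Z (Suc i)" by blast
  have Z01: "Z 0 \<subset> Z 1" and Z12: "Z 1 \<subset> Z 2" using chain[of 0] chain[of 1] d by (simp_all add: numeral_2_eq_2)
  have Z1: "irreducible_closed (Z 1)" "Z 1 \<subseteq> Y" "Z 2 \<subseteq> Y" "Z 0 \<noteq> {}"
    using Z[of 1] Z[of 2] Z[of 0] d by (auto simp: irreducible_closed_def)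
  obtain S where S: "\<forall>F\<in>S. \<exists>d. homogeneous4 d F" "Z 1 = proj_zeros S"
    using Z1(1) by (auto simp: irreducible_closed_def zariski_closed_def)
  obtain z where z: "z \<in> Z 2" "z \<notin> Z 1" using Z12 by blast
  then obtain a0 b0 where ab: "?pt a0 b0 \<noteq> 0\<^sub>v 4" "z = proj_point (?pt a0 b0)" using Y Z1(3) by blast
  then obtain F where F: "F \<in> S" "eval4 F (?pt a0 b0) \<noteq> 0"
    using z(2) proj_point_in_zeros_iff[OF _ _ S(1), of "?pt a0 b0"] S(2) by auto
  then have F0: "ev4 F (\<lambda>i. a0 * u i + b0 * w i) \<noteq> 0" by (simp add: eval4_vec)
  obtain n where n: "homogeneous4 n F" using S F by blast
  obtain h where h: "\<And>x. poly h x = ev4 F (\<lambda>i. u i + x * w i)" using ev4_along_line[of F u w] by blast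
  have scale: "ev4 F (\<lambda>i. a * u i + b * w i) = a ^ n * poly h (b / a)" if "a \<noteq> 0" for a b
    using homogeneous4_ev4[OF n, of a "\<lambda>i. u i + b / a * w i"] that by (simp add: h ring_distribs)
  have "h \<noteq> 0"
  proof
    assume "h = 0"
    \<comment> \<open>Since \<open>a0\<close> may be 0, \<open>scale\<close> does not apply
      directly. The first coefficient is varied instead: infinitely many zeros at nonzero values
      force a zero at \<open>a0\<close> too.\<close>
    obtain h' where h': "\<And>x. poly h' x = ev4 F (\<lambda>i. b0 * w i + x * u i)" using ev4_along_line[of F "\<lambda>i. b0 * w i" u] by blast
    have "poly h' x = 0" if "x \<noteq> 0" for x
      using scale[OF that, of b0] \<open>h = 0\<close> by (simp add: h' add.commute)
    then have "UNIV - {0} \<subseteq> {x. poly h' x = 0}" by auto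
    moreover have "infinite (UNIV - {0 :: 'a})" by (simp add: infinite_UNIV_char_0)
    ultimately have "h' = 0" using poly_roots_finite finite_subset by blast
    then show False using h'[of a0] F0 by (simp add: add.commute)
  qed
  \<comment> \<open>In the parameter b/a the points are roots of \<open>h\<close>; the point with a
    = 0 is listed separately.\<close>
  have "Z 1 \<subseteq> (\<lambda>x. proj_point (?pt 1 x)) ` {x. poly h x = 0} \<union> {proj_point (?pt 0 1)}"
  proof
    fix y assume y: "y \<in> Z 1"
    then obtain a b where ab: "?pt a b \<noteq> 0\<^sub>v 4" "y = proj_point (?pt a b)" using Y Z1(2) by blast
    show "y \<in> (\<lambda>x. proj_point (?pt 1 x)) ` {x. poly h x = 0} \<union> {proj_point (?pt 0 1)}"
    proof (cases "a = 0")
      case True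
      have "b \<noteq> 0" using ab(1) True by auto
      have "?pt a b = b \<cdot>\<^sub>v ?pt 0 1" using True by auto
      then show ?thesis using ab(2) proj_point_smult[OF \<open>b \<noteq> 0\<close>] by simp
    next
      case False
      have "?pt a b = a \<cdot>\<^sub>v ?pt 1 (b / a)" using False by (auto simp: field_simps)
      then have "y = proj_point (?pt 1 (b / a))" using ab(2) proj_point_smult[OF False] by simp
      moreover have "eval4 F (?pt a b) = 0"
        using y F(1) ab S proj_point_in_zeros_iff[OF _ ab(1) S(1)] by simp
      then have "poly h (b / a) = 0" using scale[OF False, of b] False by (simp add: eval4_vec)
      ultimately show ?thesis by blast
    qed
  qed
  then have fin: "finite (Z 1)" using poly_roots_finite[OF \<open>h \<noteq> 0\<close>] by (meson finite.simps finite_UnI finite_imageI finite_subset)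
  obtain P where P: "P \<in> Z 0" using Z1(4) by blast
  have "\<exists>q \<in> carrier_vec 4. q \<noteq> 0\<^sub>v 4 \<and> y = proj_point q" if "y \<in> Z 1" for y
    using that Y Z1(2) by (metis subsetD vec_carrier)
  then have cl: "zariski_closed W" if "W \<subseteq> Z 1" for W
    using zariski_closed_finite[of W] that fin finite_subset by blast
  \<comment> \<open>Subsets of the finite set \<open>Z 1\<close> are closed, so splitting off one
    point contradicts irreducibility.\<close>
  have "Z 1 = {P} \<union> (Z 1 - {P})" using P Z01 by auto
  then have "Z 1 = {P} \<or> Z 1 = Z 1 - {P}"
    using Z1(1) cl[of "{P}"] cl[of "Z 1 - {P}"] P Z01 unfolding irreducible_closed_def by blast
  then show False using P Z01 by auto
qed

text \<open>\<open>V\<close> consists of coordinate vectors for the points of \<open>X\<close>. Any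
  closed set containing \<open>X\<close> is defined by forms vanishing on \<open>V\<close>, which
  are multiples of \<open>F\<close>, so it contains all zeros of \<open>F\<close>.\<close>

lemma implicit_equation_criterion:
  fixes F :: "'a::field_char_0 quadpoly"
  assumes F: "Factorial_Ring.irreducible F" "homogeneous4 d F"
    and X: "\<And>x. x \<in> X \<Longrightarrow> \<exists>q \<in> V. q \<in> carrier_vec 4 \<and> q \<noteq> 0\<^sub>v 4 \<and> x = proj_point q"
      "\<And>q. q \<in> V \<Longrightarrow> q \<in> carrier_vec 4 \<and> q \<noteq> 0\<^sub>v 4 \<and> proj_point q \<in> X"
    and van: "\<And>q. q \<in> V \<Longrightarrow> eval4 F q = 0"
    and dvd: "\<And>G. (\<And>q. q \<in> V \<Longrightarrow> eval4 G q = 0) \<Longrightarrow> F dvd G"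
  shows "is_implicit_equation F X"
proof -
  have hF: "\<forall>G\<in>{F}. \<exists>d. homogeneous4 d G" using F(2) by blast
  have "proj_zeros {F} = zariski_closure X"
  proof
    have "X \<subseteq> proj_zeros {F}"
    proof
      fix x assume "x \<in> X"
      then obtain q where "q \<in> V" "q \<in> carrier_vec 4" "q \<noteq> 0\<^sub>v 4" "x = proj_point q" using X(1) by blast
      then show "x \<in> proj_zeros {F}" using proj_point_in_zeros_iff[OF _ _ hF] van by simp
    qed
    moreover have "zariski_closed (proj_zeros {F})" using hF unfolding zariski_closed_def by blast
    ultimately show "zariski_closure X \<subseteq> proj_zeros {F}" unfolding zariski_closure_def by blast
    show "proj_zeros {F} \<subseteq> zariski_closure X"
      unfolding zariski_closure_def
    proof (rule Inter_greatest)
      fix Z assume "Z \<in> {Z. zariski_closed Z \<and> X \<subseteq> Z}"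
      then obtain S where S: "\<forall>G\<in>S. \<exists>d. homogeneous4 d G" "Z = proj_zeros S" "X \<subseteq> Z"
        by (auto simp: zariski_closed_def)
      have "F dvd G" if "G \<in> S" for G
      proof (rule dvd)
        fix q assume "q \<in> V"
        then show "eval4 G q = 0" using X(2) S that proj_point_in_zeros_iff[OF _ _ S(1)] by blast
      qed
      then have "eval4 G p = 0" if "G \<in> S" "eval4 F p = 0" for G p
        using that unfolding eval4_eq_ev4 by (metis dvdE ev4_hom(6) mult_zero_left)
      then show "proj_zeros {F} \<subseteq> Z" unfolding S(2) proj_zeros_def by blast
    qed
  qed
  then show ?thesis unfolding is_implicit_equation_def using F by blast
qed

section \<open>Cones over parametrised curves\<close>

definition cone_point :: "(nat \<Rightarrow> 'a::comm_ring_1 bipoly) \<Rightarrow> (nat \<Rightarrow> 'a) \<Rightarrow> 'a \<Rightarrow> 'a \<Rightarrow> 'a \<Rightarrow> 'a \<Rightarrow> nat \<Rightarrow> 'a" where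
  "cone_point G \<beta> x y t v = (\<lambda>i. x * ev2 (G i) t v + y * \<beta> i)"

text \<open>All parameter values are allowed, even those giving the zero vector, so that the
  condition is the vanishing of one polynomial function of four variables.\<close>

definition vanishes_on_cone :: "(nat \<Rightarrow> 'a::comm_ring_1 bipoly) \<Rightarrow> (nat \<Rightarrow> 'a) \<Rightarrow> 'a quadpoly \<Rightarrow> bool" where
  "vanishes_on_cone G \<beta> F \<longleftrightarrow> (\<forall>x y t v. ev4 F (cone_point G \<beta> x y t v) = 0)"

lemma polyfun_cone: "polyfun (\<lambda>P. ev4 F (cone_point G \<beta> (P 0) (P 1) (P 2) (P 3)))"
  unfolding cone_point_def
  by (intro polyfun_compose polyfun_add polyfun_mult polyfun_const polyfun_ev2 polyfun_proj) simp_all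

lemma vanishes_on_cone_iff:
  fixes F :: "'a::comm_ring_1 quadpoly"
  shows "vanishes_on_cone G \<beta> F \<longleftrightarrow> (\<forall>P :: nat \<Rightarrow> 'a. ev4 F (cone_point G \<beta> (P 0) (P 1) (P 2) (P 3)) = 0)"
proof
  assume r: "\<forall>P :: nat \<Rightarrow> 'a. ev4 F (cone_point G \<beta> (P 0) (P 1) (P 2) (P 3)) = 0"
  show "vanishes_on_cone G \<beta> F" unfolding vanishes_on_cone_def
  proof (intro allI)
    fix x y t v
    show "ev4 F (cone_point G \<beta> x y t v) = 0"
      using r[rule_format, of "\<lambda>i. if i = 0 then x else if i = 1 then y else if i = 2 then t else v"]
      by simp
  qed
qed (simp add: vanishes_on_cone_def)

text \<open>Pulling back along the parametrisation lands in a domain.\<close>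

lemma vanishes_on_cone_prime:
  fixes F H :: "'a::field_char_0 quadpoly"
  assumes "vanishes_on_cone G \<beta> (F * H)"
  shows "vanishes_on_cone G \<beta> F \<or> vanishes_on_cone G \<beta> H"
proof -
  have "ev4 F (cone_point G \<beta> (P 0) (P 1) (P 2) (P 3)) * ev4 H (cone_point G \<beta> (P 0) (P 1) (P 2) (P 3)) = 0"
    for P :: "nat \<Rightarrow> 'a"
    using assms unfolding vanishes_on_cone_def ev4_hom by blast
  then show ?thesis unfolding vanishes_on_cone_iff
    by (intro polyfun_mult_eq_0[OF polyfun_cone polyfun_cone])
qed

text \<open>The product with the nonzero polynomial function x G_0(t,v) vanishes everywhere, so the
  other factor does.\<close>

lemma vanishes_on_cone_dense:
  fixes F :: "'a::field_char_0 quadpoly"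
  assumes "G 0 \<noteq> 0"
    and van: "\<And>x y t v. x \<noteq> 0 \<Longrightarrow> ev2 (G 0) t v \<noteq> 0 \<Longrightarrow> ev4 F (cone_point G \<beta> x y t v) = 0"
  shows "vanishes_on_cone G \<beta> F"
proof -
  let ?\<psi> = "\<lambda>P :: nat \<Rightarrow> 'a. P 0 * ev2 (G 0) (P 2) (P 3)"
  have "polyfun ?\<psi>" by (intro polyfun_mult polyfun_ev2 polyfun_proj) simp_all
  moreover have "?\<psi> P * ev4 F (cone_point G \<beta> (P 0) (P 1) (P 2) (P 3)) = 0" for P
    using van by auto
  ultimately have "(\<forall>P. ?\<psi> P = 0) \<or> (\<forall>P :: nat \<Rightarrow> 'a. ev4 F (cone_point G \<beta> (P 0) (P 1) (P 2) (P 3)) = 0)"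
    by (intro polyfun_mult_eq_0 polyfun_cone)
  moreover have "\<not> (\<forall>P. ?\<psi> P = 0)"
  proof
    assume z: "\<forall>P. ?\<psi> P = 0"
    have "ev2 (G 0) t v = 0" for t v
      using z[rule_format, of "\<lambda>i. if i = 0 then 1 else if i = 2 then t else v"] by simp
    then show False using ev2_eq_0_imp assms(1) by blast
  qed
  ultimately show ?thesis unfolding vanishes_on_cone_iff by blast
qed

lemma not_vanishes_on_cone_1: "\<not> vanishes_on_cone G \<beta> (1 :: 'a::field_char_0 quadpoly)"
  by (simp add: vanishes_on_cone_def)

text \<open>A nonzero polynomial with a zero is not a unit; primality of the vanishing condition
  then selects one of its irreducible factors.\<close>

lemma irreducible_factor_vanishing:
  fixes \<rho> :: "'a::field_char_0 quadpoly"
  assumes "\<rho> \<noteq> 0" "vanishes_on_cone G \<beta> \<rho>"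
  obtains F where "Factorial_Ring.irreducible F" "F dvd \<rho>" "vanishes_on_cone G \<beta> F"
proof -
  have "\<not> \<rho> dvd 1"
  proof
    assume "\<rho> dvd 1"
    then obtain u where "1 = \<rho> * u" by (elim dvdE)
    have "ev4 1 P = ev4 \<rho> P * ev4 u P" for P unfolding \<open>1 = \<rho> * u\<close> by simp
    then have "ev4 \<rho> P \<noteq> 0" for P by (metis ev4_hom(2) mult_zero_left zero_neq_one)
    then show False using assms(2) by (simp add: vanishes_on_cone_def)
  qed
  then obtain M where "mset_factors M \<rho>" using mset_factors_exist assms(1) by blast
  then have M: "\<And>f. f \<in># M \<Longrightarrow> Factorial_Ring.irreducible f" "prod_mset M = \<rho>"
    by (auto simp: mset_factors_def)
  have "\<exists>F. F \<in># M \<and> vanishes_on_cone G \<beta> F" if "vanishes_on_cone G \<beta> (prod_mset M)" for M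
    using that
  proof (induction M)
    case empty
    then show ?case by (simp add: not_vanishes_on_cone_1)
  next
    case (add x M)
    then show ?case using vanishes_on_cone_prime[of G \<beta> x "prod_mset M"] by auto
  qed
  then obtain F where "F \<in># M" "vanishes_on_cone G \<beta> F" using M(2) assms(2) by blast
  then show thesis using that M dvd_prod_mset by blast
qed

text \<open>The vertex has coordinate 1 at \<open>j\<close>, the cone is to be projected along
  coordinate \<open>l\<close>, and \<open>k\<close> is the remaining index. By
  \<open>nonconst\<close>, after coordinate \<open>j\<close> is cleared by means of the vertex,
  coordinate \<open>k\<close> of the curve is not proportional to coordinate 0.\<close>

locale cone =
  fixes G :: "nat \<Rightarrow> 'a::field_char_0 bipoly" and \<beta> :: "nat \<Rightarrow> 'a" and n j k l :: nat
  assumes idx: "{..<4} = {0, j, k, l}" "j \<noteq> 0" "k \<noteq> 0" "l \<noteq> 0" "j \<noteq> k" "j \<noteq> l" "k \<noteq> l"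
    and hom: "\<And>i. i < 4 \<Longrightarrow> homogeneous2 n (G i)"
    and G0: "G 0 \<noteq> 0" and \<beta>0: "\<beta> 0 = 0" and \<beta>j: "\<beta> j = 1"
    and nonconst: "\<And>e. G k - Polynomial.smult [:\<beta> k:] (G j) \<noteq> Polynomial.smult [:e:] (G 0)"
begin

lemma idx_less: "j < 4" "k < 4" "l < 4"
  using idx(1) by (metis insertI1 insertI2 lessThan_iff)+

text \<open>Dehomogenisation is injective on forms of degree \<open>n\<close>, so
  \<open>nonconst\<close> survives it.\<close>

lemma num_den_independent:
  assumes "Polynomial.smult a (dehom (G k - Polynomial.smult [:\<beta> k:] (G j))) = Polynomial.smult b (dehom (G 0))"
  shows "a = 0"
proof (rule ccontr)
  assume "a \<noteq> 0"
  define D where "D = G k - Polynomial.smult [:\<beta> k:] (G j) - Polynomial.smult [:b / a:] (G 0)"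
  have "homogeneous2 n D"
    unfolding homogeneous2_def D_def
  proof (intro allI impI)
    fix i m assume "coeff (coeff (G k - Polynomial.smult [:\<beta> k:] (G j) - Polynomial.smult [:b / a:] (G 0)) i) m \<noteq> 0"
    then have "coeff (coeff (G k) i) m \<noteq> 0 \<or> coeff (coeff (G j) i) m \<noteq> 0 \<or> coeff (coeff (G 0) i) m \<noteq> 0"
      by auto
    then show "i + m = n" using hom[of k] hom[of j] hom[of 0] idx_less unfolding homogeneous2_def by force
  qed
  moreover have "dehom D = 0"
  proof (rule poly_eqI)
    fix i
    have "a * coeff (dehom (G k - Polynomial.smult [:\<beta> k:] (G j))) i = b * coeff (dehom (G 0)) i"
      using arg_cong[OF assms, of "\<lambda>p. coeff p i"] by simp
    then show "coeff (dehom D) i = coeff 0 i"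
      using \<open>a \<noteq> 0\<close> by (simp add: coeff_dehom D_def field_simps)
  qed
  ultimately have "D = 0" by (rule dehom_eq_0_imp)
  then show False using nonconst[of "b / a"] by (simp add: D_def)
qed

text \<open>
  For fixed coordinates 0 and \<open>j\<close>, the coordinate \<open>k\<close> of the points of the cone takes infinitely
  many values, so the cone projects densely along coordinate \<open>l\<close>.
\<close>

lemma zero_of_vanishing_independent:
  assumes van: "vanishes_on_cone G \<beta> r" and indep: "\<And>P x. ev4 r (P(l := x)) = ev4 r P"
  shows "r = 0"
proof -
  define num where "num = dehom (G k - Polynomial.smult [:\<beta> k:] (G j))"
  define den where "den = dehom (G 0)"
  have num: "poly num t = ev2 (G k) t 1 - \<beta> k * ev2 (G j) t 1" and den: "poly den t = ev2 (G 0) t 1" for t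
    unfolding num_def den_def ev2_dehom[symmetric] by simp_all
  have "den \<noteq> 0" unfolding den_def using dehom_eq_0_imp[OF hom[of 0]] G0 by auto
  have zero: "ev4 r P = 0" if P0: "P 0 \<noteq> 0" for P
  proof -
    define u where "u = P(k := 0)"
    define w where "w = (\<lambda>i. if i = k then 1 else 0 :: 'a)"
    obtain h where h: "\<And>x. poly h x = ev4 r (\<lambda>i. u i + x * w i)"
      using ev4_along_line[of r u w] by blast
    have uw: "(\<lambda>i. u i + x * w i) = P(k := x)" for x by (auto simp: u_def w_def)
    \<comment> \<open>Coordinate \<open>k\<close> of the cone point over \<open>(t, 1)\<close> whose
      coordinates 0 and \<open>j\<close> agree with those of \<open>P\<close>.\<close>
    define \<xi> where "\<xi> t = \<beta> k * P j + P 0 * (poly num t / poly den t)" for t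
    have root: "poly h (\<xi> t) = 0" if t: "poly den t \<noteq> 0" for t
    proof -
      \<comment> \<open>As the vertex has entries 0 at index 0 and 1 at index \<open>j\<close>,
        coordinate 0 fixes the multiple of the curve point and coordinate \<open>j\<close> then
        fixes that of the vertex.\<close>
      define x where "x = P 0 / poly den t"
      define Q where "Q = cone_point G \<beta> x (P j - x * ev2 (G j) t 1) t 1"
      have "Q 0 = P 0" "Q j = P j" "Q k = \<xi> t"
        using t by (simp_all add: Q_def cone_point_def \<beta>0 \<beta>j x_def \<xi>_def num den field_simps)
      then have "ev4 r ((P(k := \<xi> t))(l := Q l)) = ev4 r Q"
        using idx by (intro ev4_cong) (metis (no_types, lifting) fun_upd_apply insertE lessThan_iff singletonD)
      also have "\<dots> = 0" using van unfolding Q_def vanishes_on_cone_def by blast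
      finally show ?thesis by (simp add: h uw indep)
    qed
    have "h = 0"
    proof (rule ccontr)
      assume "h \<noteq> 0"
      let ?T = "{t. poly den t \<noteq> 0}"
      have "infinite ?T"
      proof
        assume "finite ?T"
        then have "finite (?T \<union> {t. poly den t = 0})" using poly_roots_finite[OF \<open>den \<noteq> 0\<close>] by simp
        moreover have "?T \<union> {t. poly den t = 0} = UNIV" by auto
        ultimately show False by (simp add: infinite_UNIV_char_0)
      qed
      \<comment> \<open>Finitely many roots of \<open>h\<close> leave finitely many values of
        \<open>\<xi>\<close>, so one is taken infinitely often; this makes \<open>num\<close> and
        \<open>den\<close> linearly dependent.\<close>
      moreover have "finite (\<xi> ` ?T)"
        using poly_roots_finite[OF \<open>h \<noteq> 0\<close>] by (rule rev_finite_subset) (auto simp: root)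
      ultimately obtain t0 where t0: "infinite {t \<in> ?T. \<xi> t = \<xi> t0}"
        using pigeonhole_infinite by blast
      define p where "p = Polynomial.smult (P 0) num - Polynomial.smult (\<xi> t0 - \<beta> k * P j) den"
      have "poly p t = 0" if "t \<in> ?T" "\<xi> t = \<xi> t0" for t
      proof -
        have "\<xi> t0 - \<beta> k * P j = P 0 * (poly num t / poly den t)" using that(2)[symmetric] by (simp add: \<xi>_def)
        then show ?thesis using that(1) by (simp add: p_def)
      qed
      then have "{t \<in> ?T. \<xi> t = \<xi> t0} \<subseteq> {t. poly p t = 0}" by blast
      then have "p = 0" using t0 poly_roots_finite finite_subset by blast
      then show False using num_den_independent[of "P 0"] P0 unfolding p_def num_def den_def by auto
    qed
    then have "ev4 r (P(k := P k)) = 0" using h[of "P k"] unfolding uw by simp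
    then show ?thesis by simp
  qed
  \<comment> \<open>Points with coordinate 0 equal to 0 are reached by multiplying with that
    coordinate function.\<close>
  have "polyfun (\<lambda>P. P 0 :: 'a)" by (rule polyfun_proj) simp
  from polyfun_mult_eq_0[OF this polyfun_ev4, of r]
  have "(\<forall>P :: nat \<Rightarrow> 'a. P 0 = 0) \<or> (\<forall>P. ev4 r P = 0)" using zero by auto
  moreover have "\<not> (\<forall>P :: nat \<Rightarrow> 'a. P 0 = 0)" by (auto intro: exI[of _ "\<lambda>_. 1"])
  ultimately show ?thesis using ev4_eq_0_imp by blast
qed

lemma vanishing_ideal_principal:
  assumes F: "Factorial_Ring.irreducible F" "vanishes_on_cone G \<beta> F" and H: "vanishes_on_cone G \<beta> H"
  shows "F dvd H"
proof (rule ccontr)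
  assume "\<not> F dvd H"
  then obtain r where r: "r \<noteq> 0" "\<And>P. ev4 F P = 0 \<Longrightarrow> ev4 H P = 0 \<Longrightarrow> ev4 r P = 0"
    "\<And>P x. ev4 r (P(l := x)) = ev4 r P"
    using eliminate_variable[OF F(1) _ idx_less(3)] by blast
  have "vanishes_on_cone G \<beta> r" using F(2) H r(2) unfolding vanishes_on_cone_def by blast
  then show False using zero_of_vanishing_independent r by blast
qed

text \<open>The cone is stable under scaling, so scaling sends \<open>F\<close> to polynomials
  vanishing on the cone, which are multiples of \<open>F\<close>.\<close>

lemma vanishing_generator_homogeneous:
  assumes F: "Factorial_Ring.irreducible F" "vanishes_on_cone G \<beta> F"
  shows "\<exists>d. homogeneous4 d F"
proof -
  have pt: "(\<lambda>i. c * cone_point G \<beta> x y t v i) = cone_point G \<beta> (c * x) (c * y) t v" for c x y t v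
    by (auto simp: cone_point_def algebra_simps)
  have "vanishes_on_cone G \<beta> (scale4 c F)" for c
    using F(2) by (simp add: vanishes_on_cone_def ev4_scale4 pt)
  then have dvd: "F dvd scale4 c F" for c using vanishing_ideal_principal F by blast
  \<comment> \<open>Divisibility for the factor 1/2, rescaled by 2, is the converse divisibility for
    the factor 2.\<close>
  obtain E where E: "scale4 (1 / 2) F = F * E" using dvd[of "1/2"] by (elim dvdE)
  have "F = scale4 2 F * scale4 2 E"
  proof (rule ev4_eq_imp)
    fix P :: "nat \<Rightarrow> 'a"
    have "ev4 F P = ev4 (scale4 (1 / 2) F) (\<lambda>i. 2 * P i)" by (simp add: ev4_scale4)
    then show "ev4 F P = ev4 (scale4 2 F * scale4 2 E) P" by (simp add: E ev4_scale4)
  qed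
  then have "scale4 2 F dvd F" by (metis dvd_triv_left)
  then show ?thesis using homogeneous4_of_associated_scale[of F] dvd F(1) by auto
qed

end

section \<open>Normalised syzygies\<close>

lemma lessThan_4: "{..<4::nat} = {0, 1, 2, 3}"
  by auto

lemma homogeneous2_smult:
  fixes p :: "'a::idom bipoly"
  shows "homogeneous2 d p \<Longrightarrow> homogeneous2 d (Polynomial.smult [:c:] p)"
  by (simp add: homogeneous2_def)

lemma homogeneous2_add:
  assumes "homogeneous2 d p" "homogeneous2 d q"
  shows "homogeneous2 d (p + q)"
  unfolding homogeneous2_def
proof (intro allI impI)
  fix i j assume "coeff (coeff (p + q) i) j \<noteq> 0"
  then have "coeff (coeff p i) j \<noteq> 0 \<or> coeff (coeff q i) j \<noteq> 0" by auto
  then show "i + j = d" using assms unfolding homogeneous2_def by blast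
qed

lemma homogeneous2_diff:
  fixes p q :: "'a::comm_ring_1 bipoly"
  assumes "homogeneous2 d p" "homogeneous2 d q"
  shows "homogeneous2 d (p - q)"
  unfolding homogeneous2_def
proof (intro allI impI)
  fix i j assume "coeff (coeff (p - q) i) j \<noteq> 0"
  then have "coeff (coeff p i) j \<noteq> 0 \<or> coeff (coeff q i) j \<noteq> 0" by auto
  then show "i + j = d" using assms unfolding homogeneous2_def by blast
qed

text \<open>Scaling by 2 and cancelling \<open>p\<close> determines the degree of each monomial of
  \<open>q\<close>. A nonzero coefficient of \<open>q\<close> already forces k \<le> n, so the
  subtraction does not truncate.\<close>

lemma homogeneous4_quotient:
  fixes p q :: "'a::field_char_0 quadpoly"
  assumes p: "homogeneous4 k p" "p \<noteq> 0" and pq: "homogeneous4 n (p * q)"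
  shows "homogeneous4 (n - k) q"
  unfolding homogeneous4_def
proof (intro allI impI)
  fix a b c d assume nz: "coeff (coeff (coeff (coeff q a) b) c) d \<noteq> 0"
  have "p * ([:[:[:[:2 ^ k:]:]:]:] * scale4 2 q) = p * ([:[:[:[:2 ^ n:]:]:]:] * q)"
  proof (rule ev4_eq_imp)
    fix P :: "nat \<Rightarrow> 'a"
    have "ev4 (p * q) (\<lambda>i. 2 * P i) = 2 ^ n * ev4 (p * q) P" by (rule homogeneous4_ev4[OF pq])
    then have "2 ^ k * ev4 p P * ev4 q (\<lambda>i. 2 * P i) = 2 ^ n * (ev4 p P * ev4 q P)"
      by (simp add: homogeneous4_ev4[OF p(1)])
    then show "ev4 (p * ([:[:[:[:2 ^ k:]:]:]:] * scale4 2 q)) P = ev4 (p * ([:[:[:[:2 ^ n:]:]:]:] * q)) P"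
      unfolding ev4_hom ev4_scale4 by (simp only: mult_ac)
  qed
  then have "[:[:[:[:2 ^ k:]:]:]:] * scale4 2 q = [:[:[:[:2 ^ n:]:]:]:] * q"
    using mult_left_cancel[OF p(2)] by blast
  then have "coeff (coeff (coeff (coeff ([:[:[:[:2 ^ k:]:]:]:] * scale4 2 q) a) b) c) d
      = coeff (coeff (coeff (coeff ([:[:[:[:2 ^ n:]:]:]:] * q) a) b) c) d" by (simp only:)
  then have "2 ^ (k + (a + b + c + d)) * coeff (coeff (coeff (coeff q a) b) c) d
      = 2 ^ n * coeff (coeff (coeff (coeff q a) b) c) d"
    by (simp add: coeff_scale4 power_add mult_ac)
  then have "(of_nat (2 ^ (k + (a + b + c + d))) :: 'a) = of_nat (2 ^ n)" using nz by auto
  then have "(2::nat) ^ (k + (a + b + c + d)) = 2 ^ n" by (simp only: of_nat_eq_iff)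
  then have "k + (a + b + c + d) = n" by simp
  then show "a + b + c + d = n - k" by simp
qed

text \<open>Scaling the variables maps common divisors of forms to common divisors, so it fixes their gcd up to a unit.\<close>

lemma homogeneous_gcd:
  fixes dd :: "'a::field_char_0 quadpoly"
  assumes gcd: "is_gcd_set dd S" and hom: "\<And>x. x \<in> S \<Longrightarrow> homogeneous4 n x" and "dd \<noteq> 0"
  shows "\<exists>k. homogeneous4 k dd"
proof -
  have dvd: "scale4 c dd dvd dd" if c: "c \<noteq> 0" for c
  proof -
    have "scale4 c dd dvd x" if x: "x \<in> S" for x
    proof -
      have "dd dvd x" using gcd x by (simp add: is_gcd_set_def)
      then obtain y where y: "x = dd * y" by (elim dvdE)
      have "x = scale4 c dd * ([:[:[:[:(1 / c) ^ n:]:]:]:] * scale4 c y)"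
      proof (rule ev4_eq_imp)
        fix P
        have "ev4 x (\<lambda>i. c * P i) = c ^ n * ev4 x P" by (rule homogeneous4_ev4[OF hom[OF x]])
        then have "ev4 x P = (1 / c) ^ n * (ev4 dd (\<lambda>i. c * P i) * ev4 y (\<lambda>i. c * P i))"
          using c by (simp add: y power_divide)
        then show "ev4 x P = ev4 (scale4 c dd * ([:[:[:[:(1 / c) ^ n:]:]:]:] * scale4 c y)) P"
          unfolding ev4_hom ev4_scale4 by (simp only: mult_ac)
      qed
      then show ?thesis by (metis dvd_triv_left)
    qed
    then show ?thesis using gcd by (simp add: is_gcd_set_def)
  qed
  obtain E where E: "dd = scale4 (1 / 2) dd * E" using dvd[of "1 / 2"] by (auto elim: dvdE)
  have "scale4 2 dd = dd * scale4 2 E"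
  proof (rule ev4_eq_imp)
    fix P :: "nat \<Rightarrow> 'a"
    have "ev4 dd (\<lambda>i. 2 * P i) = ev4 (scale4 (1 / 2) dd * E) (\<lambda>i. 2 * P i)" using E by simp
    then show "ev4 (scale4 2 dd) P = ev4 (dd * scale4 2 E) P" by (simp add: ev4_scale4)
  qed
  then have "dd dvd scale4 2 dd" by simp
  then show ?thesis using homogeneous4_of_associated_scale[OF \<open>dd \<noteq> 0\<close>] dvd[of 2] by simp
qed

text \<open>Degrees in the two outer variables add up to 0, so both factors are free of
  them.\<close>

lemma factor_of_constant:
  fixes p q :: "'a::idom quadpoly"
  assumes "p * q = tv_to_R e" "e \<noteq> 0"
  shows "p = tv_to_R (coeff (coeff p 0) 0)"
proof -
  have *: "\<exists>a. r = [:a:]" if "r * s = [:c:]" "c \<noteq> 0" for r s :: "'b::idom poly" and c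
  proof -
    have "r \<noteq> 0" "s \<noteq> 0" using that by auto
    from degree_mult_eq[OF this] have "degree r = 0" using that(1) by simp
    then show ?thesis by (metis degree_eq_zeroE)
  qed
  obtain p1 where p1: "p = [:p1:]" using *[of p q "[:e:]"] assms by (auto simp: tv_to_R_def)
  obtain q1 where q1: "q = [:q1:]" using *[of q p "[:e:]"] assms by (auto simp: tv_to_R_def mult.commute)
  have "p1 * q1 = [:e:]" using assms(1) unfolding p1 q1 by (simp add: tv_to_R_def mult.commute)
  then obtain p2 where "p1 = [:p2:]" using *[of p1 q1 e] assms(2) by blast
  then show ?thesis using p1 by (simp add: tv_to_R_def)
qed

lemma tv_to_R_hom:
  "tv_to_R (p * q) = tv_to_R p * tv_to_R q" "tv_to_R (p + q) = tv_to_R p + tv_to_R q" "tv_to_R 0 = 0"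
  "tv_to_R p = tv_to_R q \<longleftrightarrow> p = q"
  by (simp_all add: tv_to_R_def)

text \<open>The entries of \<open>N\<^sub>g a\<close> for a constant vector \<open>a = c\<close>.\<close>

definition moving_entry :: "'a::field bipoly vec \<Rightarrow> (nat \<Rightarrow> 'a) \<Rightarrow> nat \<Rightarrow> 'a bipoly" where
  "moving_entry g c i = (if i = 0
     then Polynomial.smult [:1 / 2:] (Polynomial.smult [:c 0:] (g $ 0) - (\<Sum>r\<in>{1,2,3}. Polynomial.smult [:c r:] (g $ r)))
     else Polynomial.smult [:c i:] (g $ 0))"

lemma N_mult_const:
  fixes g a :: "'a::field_char_0 bipoly vec"
  assumes a: "a \<in> carrier_vec 4" "\<And>i. i < 4 \<Longrightarrow> a $ i = [:[:c i:]:]"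
  shows "N_mult g a = map_vec tv_to_R (vec 4 (moving_entry g c))"
proof (rule eq_vecI)
  fix i assume "i < dim_vec (map_vec tv_to_R (vec 4 (moving_entry g c)))"
  then have i: "i < 4" by simp
  have dim: "dim_row (N_mat g) = 4" "dim_col (N_mat g) = 4" by (simp_all add: N_mat_def mat_of_rows_list_def)
  have "N_mult g a $ i = (\<Sum>r<4. tv_to_R (N_mat g $$ (i, r)) * su_to_R (a $ r))"
    using a(1) i dim by (simp add: N_mult_def scalar_prod_def lessThan_atLeast0)
  also have "\<dots> = tv_to_R (moving_entry g c i)"
  proof (rule ev4_eq_imp)
    fix P :: "nat \<Rightarrow> 'a"
    have "i = 0 \<or> i = 1 \<or> i = 2 \<or> i = 3" using i by linarith
    then show "ev4 (\<Sum>r<4. tv_to_R (N_mat g $$ (i, r)) * su_to_R (a $ r)) P = ev4 (tv_to_R (moving_entry g c i)) P"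
      by (elim disjE) (simp_all add: lessThan_4 a(2) N_mat_def mat_of_rows_list_def moving_entry_def
          numeral_2_eq_2 numeral_3_eq_3 algebra_simps diff_divide_distrib)
  qed
  finally show "N_mult g a $ i = map_vec tv_to_R (vec 4 (moving_entry g c)) $ i" using i by simp
qed (simp add: N_mult_def N_mat_def mat_of_rows_list_def)

text \<open>All entries lie in \<open>K[t,v]\<close>, and those of index 1 to 3 are constant
  multiples of g_0; dividing by the gcd \<open>D\<close> leaves multiples of the single form
  \<gamma> = g_0/D. A common zero of \<gamma> and entry 0 would give a linear form by which the gcd
  could be enlarged.\<close>

lemma normalized_syzygy:
  fixes g a :: "'a::field_char_0 bipoly vec"
  assumes g: "\<And>i. i < 4 \<Longrightarrow> homogeneous2 n (g $ i)" "g $ 0 \<noteq> 0"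
    and a: "a \<in> carrier_vec 4" "\<And>i. i < 4 \<Longrightarrow> a $ i = [:[:c i:]:]"
    and r: "r \<in> {1, 2, 3}" "c r \<noteq> 0"
    and gcd: "is_gcd_set dA (set\<^sub>v (N_mult g a))" and eq: "N_mult g a = dA \<cdot>\<^sub>v A"
  obtains A' :: "'a bipoly vec" and \<gamma> D d where "A = map_vec tv_to_R A'" "A' \<in> carrier_vec 4"
    "\<And>i. i < 4 \<Longrightarrow> homogeneous2 d (A' $ i)" "homogeneous2 d \<gamma>"
    "\<And>i. i \<in> {1, 2, 3} \<Longrightarrow> A' $ i = Polynomial.smult [:c i:] \<gamma>"
    "D * \<gamma> = g $ 0" "D * A' $ 0 = moving_entry g c 0"
    "\<And>t v. (t, v) \<noteq> (0, 0) \<Longrightarrow> ev2 (A' $ 0) t v \<noteq> 0 \<or> ev2 \<gamma> t v \<noteq> 0"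
proof -
  have N: "N_mult g a = map_vec tv_to_R (vec 4 (moving_entry g c))"
    by (rule N_mult_const) (use a in auto)
  have sv: "set\<^sub>v (N_mult g a) = (\<lambda>i. tv_to_R (moving_entry g c i)) ` {..<4}"
    unfolding N by (auto simp: vec_set_def)
  have dimA: "dim_vec A = 4" using arg_cong[OF eq, of dim_vec] N by simp
  have e: "dA * A $ i = tv_to_R (moving_entry g c i)" if "i < 4" for i
    using arg_cong[OF eq, of "\<lambda>x. vec_index x i"] N that dimA by simp
  have r4: "r < 4" "r \<noteq> 0" using r by auto
  have nzr: "moving_entry g c r \<noteq> 0" using r g(2) r4 by (simp add: moving_entry_def)
  define D where "D = coeff (coeff dA 0) 0"
  have dA: "dA = tv_to_R D" unfolding D_def by (rule factor_of_constant[OF e[OF r4(1)] nzr])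
  have "dA \<noteq> 0" using e[OF r4(1)] nzr by (auto simp: tv_to_R_def)
  then have "D \<noteq> 0" using dA by (auto simp: tv_to_R_def)
  define A' where "A' = vec 4 (\<lambda>i. coeff (coeff (A $ i) 0) 0)"
  have A': "A $ i = tv_to_R (A' $ i)" if "i < 4" for i
  \<comment> \<open>A factor of 0 carries no degree information, so zero entries are treated
    separately.\<close>
  proof (cases "moving_entry g c i = 0")
    case True
    then have "A $ i = 0" using e[OF that] \<open>dA \<noteq> 0\<close> by (simp add: tv_to_R_hom)
    then show ?thesis using that by (simp add: A'_def tv_to_R_hom)
  next
    case False
    show ?thesis using factor_of_constant[of "A $ i" dA, OF _ False] e[OF that] that
      by (simp add: A'_def mult.commute)
  qed
  have DA': "D * A' $ i = moving_entry g c i" if "i < 4" for i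
    using e[OF that] unfolding A'[OF that] dA by (simp add: tv_to_R_hom flip: tv_to_R_hom(1))
  have homN: "homogeneous2 n (moving_entry g c i)" if "i < 4" for i
    unfolding moving_entry_def using that
    by (auto intro!: homogeneous2_smult homogeneous2_diff homogeneous2_add g(1))
  have "homogeneous4 n x" if "x \<in> set\<^sub>v (N_mult g a)" for x
  proof -
    obtain i where "i < 4" "x = tv_to_R (moving_entry g c i)" using \<open>x \<in> _\<close> sv by auto
    then show ?thesis using homN by (simp flip: homogeneous2_iff)
  qed
  then obtain k where k: "homogeneous4 k dA" using homogeneous_gcd[OF gcd _ \<open>dA \<noteq> 0\<close>] by blast
  have homA': "homogeneous2 (n - k) (A' $ i)" if "i < 4" for i
    unfolding homogeneous2_iff A'[OF that, symmetric]
    by (rule homogeneous4_quotient[OF k \<open>dA \<noteq> 0\<close>]) (simp add: e[OF that] homN[OF that] flip: homogeneous2_iff)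
  \<comment> \<open>Entry \<open>r\<close> has a nonzero constant, so g_0/D can be read off from
    it.\<close>
  define \<gamma> where "\<gamma> = Polynomial.smult [:1 / c r:] (A' $ r)"
  have hom\<gamma>: "homogeneous2 (n - k) \<gamma>"
    using homA'[OF r4(1)] unfolding homogeneous2_def \<gamma>_def by auto
  have D\<gamma>: "D * \<gamma> = g $ 0"
    using DA'[OF r4(1)] r r4 by (simp add: \<gamma>_def moving_entry_def)
  have A'\<gamma>: "A' $ i = Polynomial.smult [:c i:] \<gamma>" if "i \<in> {1, 2, 3}" for i
  proof -
    have "i < 4" "i \<noteq> 0" using that by auto
    then have "D * A' $ i = D * Polynomial.smult [:c i:] \<gamma>" 
      using DA'[of i] D\<gamma> by (simp add: moving_entry_def)
    then show ?thesis using \<open>D \<noteq> 0\<close> mult_left_cancel by blast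
  qed
  have nz: "ev2 (A' $ 0) t v \<noteq> 0 \<or> ev2 \<gamma> t v \<noteq> 0" if tv: "(t, v) \<noteq> (0, 0)" for t v
  proof (rule ccontr)
    assume "\<not> ?thesis"
    then have z: "ev2 (A' $ 0) t v = 0" "ev2 \<gamma> t v = 0" by auto
    define L where "L = [:[:0, - t:], [:v:]:]"
    have L0: "L dvd A' $ 0" and L\<gamma>: "L dvd \<gamma>"
      unfolding L_def using linear_form_dvd[OF homA'[of 0] z(1) tv] linear_form_dvd[OF hom\<gamma> z(2) tv] by simp_all
    have "L dvd A' $ i" if "i < 4" for i
    proof (cases "i = 0")
      case False
      then have "i \<in> {1, 2, 3}" using that by auto
      then show ?thesis using A'\<gamma> L\<gamma> by (simp add: dvd_smult)
    qed (use L0 in simp)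
    \<comment> \<open>\<open>D * L\<close> is a common divisor and so divides the gcd
      \<open>D\<close>, which would make the linear form a unit.\<close>
    then have "D * L dvd moving_entry g c i" if "i < 4" for i
      using that unfolding DA'[OF that, symmetric] by (intro mult_dvd_mono) auto
    then have "tv_to_R (D * L) dvd tv_to_R (moving_entry g c i)" if "i < 4" for i
      using that by (metis dvdE dvd_triv_left tv_to_R_hom(1))
    then have "tv_to_R (D * L) dvd x" if "x \<in> set\<^sub>v (N_mult g a)" for x
      using that sv by auto
    then have "tv_to_R (D * L) dvd dA" using gcd unfolding is_gcd_set_def by blast
    then have "dA * tv_to_R L dvd dA * 1" unfolding dA tv_to_R_hom(1) by simp
    then have "is_unit (tv_to_R L)" unfolding dvd_mult_cancel_left using \<open>dA \<noteq> 0\<close> by simp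
    then have "is_unit L" by (simp add: tv_to_R_def is_unit_poly_iff)
    then show False using linear_form_not_unit[OF tv] by (simp add: L_def)
  qed
  show thesis
  proof (rule that)
    show "A = map_vec tv_to_R A'" by (rule eq_vecI) (use A' dimA in \<open>auto simp: A'_def\<close>)
    show "A' \<in> carrier_vec 4" by (simp add: A'_def)
    show "D * A' $ 0 = moving_entry g c 0" using DA'[of 0] by simp
  qed (use homA' hom\<gamma> A'\<gamma> D\<gamma> nz in blast)+
qed

section \<open>Specialising the resultant\<close>

text \<open>The form of \<open>x_mult\<close> with its coordinates specialised to the point
  \<open>P\<close>.\<close>

definition x_eval :: "'a::comm_ring_1 bipoly vec \<Rightarrow> (nat \<Rightarrow> 'a) \<Rightarrow> 'a bipoly" where
  "x_eval A P = (\<Sum>r<4. Polynomial.smult [:P r:] (A $ r))"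

lemma x_mult_sum:
  fixes A :: "'a::comm_ring_1 bipoly vec"
  assumes "A \<in> carrier_vec 4"
  shows "x_mult A = (\<Sum>r<4. [:[:wxyz $ r:]:] * map_poly (map_poly (\<lambda>c. [:[:[:[:c:]:]:]:])) (A $ r))"
  using assms by (simp add: x_mult_def scalar_prod_def wxyz_def lessThan_atLeast0)

lemma coeff_x_mult:
  fixes A :: "'a::comm_ring_1 bipoly vec"
  assumes "A \<in> carrier_vec 4"
  shows "coeff (x_mult A) i = (\<Sum>r<4. Polynomial.smult (wxyz $ r) (map_poly (\<lambda>c. [:[:[:[:c:]:]:]:]) (coeff (A $ r) i)))"
  unfolding x_mult_sum[OF assms] coeff_sum by (rule sum.cong) (simp_all add: coeff_map_poly)

lemma homogeneous2_x_mult: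
  fixes A :: "'a::comm_ring_1 bipoly vec"
  assumes "A \<in> carrier_vec 4" "\<And>r. r < 4 \<Longrightarrow> homogeneous2 d (A $ r)"
  shows "homogeneous2 d (x_mult A)"
  unfolding homogeneous2_def
proof (intro allI impI, rule ccontr)
  fix i m assume nz: "coeff (coeff (x_mult A) i) m \<noteq> 0" and "i + m \<noteq> d"
  then have "coeff (coeff (A $ r) i) m = 0" if "r < 4" for r
    using assms(2)[OF that] unfolding homogeneous2_def by blast
  then have "coeff (coeff (x_mult A) i) m = 0"
    unfolding coeff_x_mult[OF assms(1)] coeff_sum by (intro sum.neutral) (simp add: coeff_map_poly)
  then show False using nz by simp
qed

lemma dehom_x_eval:
  fixes A :: "'a::comm_ring_1 bipoly vec"
  assumes "A \<in> carrier_vec 4"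
  shows "map_poly (\<lambda>c. ev4 c P) (dehom (x_mult A)) = dehom (x_eval A P)"
proof (rule poly_eqI)
  fix i
  have c: "poly (map_poly (\<lambda>c. [:[:[:[:c:]:]:]:]) q) 1 = [:[:[:[:poly q 1:]:]:]:]" for q :: "'a poly"
    by (induction q) (auto simp: map_poly_pCons)
  have "coeff (map_poly (\<lambda>c. ev4 c P) (dehom (x_mult A))) i
      = ev4 (\<Sum>r<4. wxyz $ r * [:[:[:[:poly (coeff (A $ r) i) 1:]:]:]:]) P"
    by (simp add: coeff_map_poly coeff_dehom coeff_x_mult[OF assms] poly_sum c)
  also have "\<dots> = (\<Sum>r<4. P r * poly (coeff (A $ r) i) 1)"
    unfolding ev4_sum ev4_hom by (rule sum.cong) simp_all
  also have "\<dots> = coeff (dehom (x_eval A P)) i"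
    by (simp add: coeff_dehom x_eval_def coeff_sum poly_sum)
  finally show "coeff (map_poly (\<lambda>c. ev4 c P) (dehom (x_mult A))) i = coeff (dehom (x_eval A P)) i" .
qed

text \<open>The Sylvester matrix is formed for fixed degrees, so it commutes with evaluation even
  where leading coefficients vanish.\<close>

lemma ev4_Res_tv:
  fixes P :: "nat \<Rightarrow> 'a::comm_ring_1"
  assumes "A \<in> carrier_vec 4" "B \<in> carrier_vec 4"
  shows "ev4 (Res_tv d e (x_mult A) (x_mult B)) P = Res_tv d e (x_eval A P) (x_eval B P)"
proof -
  interpret h: comm_ring_hom "\<lambda>p. ev4 p P" by unfold_locales simp_all
  have "ev4 (Res_tv d e (x_mult A) (x_mult B)) P
      = det (map_mat (\<lambda>p. ev4 p P) (sylvester_mat_sub d e (dehom (x_mult A)) (dehom (x_mult B))))"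
    unfolding h.hom_det by (simp add: Res_tv_def dehom_def)
  also have "\<dots> = Res_tv d e (x_eval A P) (x_eval B P)"
    by (simp add: sylvester_mat_sub_map dehom_x_eval assms Res_tv_def flip: dehom_def)
  finally show ?thesis .
qed

text \<open>Each index excludes at most one value of \<open>z\<close>, and the field is
  infinite.\<close>

lemma avoid_zeros:
  fixes p q :: "'i \<Rightarrow> 'a::field_char_0"
  assumes "finite T" "\<And>\<tau>. \<tau> \<in> T \<Longrightarrow> p \<tau> \<noteq> 0 \<or> q \<tau> \<noteq> 0"
  obtains z where "\<And>\<tau>. \<tau> \<in> T \<Longrightarrow> p \<tau> + z * q \<tau> \<noteq> 0"
proof -
  obtain z where z: "z \<notin> (\<lambda>\<tau>. - p \<tau> / q \<tau>) ` T"
    using ex_new_if_finite[OF infinite_UNIV_char_0] assms(1) by blast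
  have "p \<tau> + z * q \<tau> \<noteq> 0" if "\<tau> \<in> T" for \<tau>
  proof
    assume s: "p \<tau> + z * q \<tau> = 0"
    then have "q \<tau> \<noteq> 0" using assms(2)[OF that] by auto
    have "z * q \<tau> = - p \<tau>" using s by (simp add: add_eq_0_iff)
    then have "z = - p \<tau> / q \<tau>" using \<open>q \<tau> \<noteq> 0\<close> by (metis nonzero_mult_div_cancel_right)
    then show False using z that by blast
  qed
  then show thesis using that by blast
qed

text \<open>First \<open>lam\<close> is chosen so that the first form is nonzero at infinity and
  keeps full degree, then \<open>mu\<close> so that the second avoids the finitely many zeros of the
  first.\<close>

lemma generic_resultant_nonzero:
  fixes p0 p1 q0 q1 :: "'a::{alg_closed_field, field_char_0} bipoly"
  assumes p: "homogeneous2 d p0" "homogeneous2 d p1" and q: "homogeneous2 e q0" "homogeneous2 e q1"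
    and pz: "\<And>t v. (t, v) \<noteq> (0, 0) \<Longrightarrow> ev2 p0 t v \<noteq> 0 \<or> ev2 p1 t v \<noteq> 0"
    and qz: "\<And>t v. (t, v) \<noteq> (0, 0) \<Longrightarrow> ev2 q0 t v \<noteq> 0 \<or> ev2 q1 t v \<noteq> 0"
  obtains lam mu where "Res_tv d e (p0 + Polynomial.smult [:lam:] p1) (q0 + Polynomial.smult [:mu:] q1) \<noteq> 0"
proof -
  have hom: "homogeneous2 d' (r + Polynomial.smult [:z:] s)" if "homogeneous2 d' r" "homogeneous2 d' s"
    for d' z and r s :: "'a bipoly"
    by (intro homogeneous2_add homogeneous2_smult that)
  have "ev2 p0 1 0 \<noteq> 0 \<or> ev2 p1 1 0 \<noteq> 0" by (rule pz) simp
  then obtain lam where lam: "ev2 p0 1 0 + lam * ev2 p1 1 0 \<noteq> 0"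
    using avoid_zeros[of "{()}" "\<lambda>_. ev2 p0 1 0" "\<lambda>_. ev2 p1 1 0"] by auto
  define p where "p = p0 + Polynomial.smult [:lam:] p1"
  have hp: "homogeneous2 d p" unfolding p_def by (rule hom[OF p])
  have cd: "coeff (dehom p) d \<noteq> 0"
    using lam ev2_infinity[OF hp, of 1] by (simp add: p_def)
  then have "finite {t. poly (dehom p) t = 0}" by (intro poly_roots_finite) auto
  moreover have "ev2 q0 t 1 \<noteq> 0 \<or> ev2 q1 t 1 \<noteq> 0" for t by (rule qz) simp
  ultimately obtain mu where mu: "\<And>t. poly (dehom p) t = 0 \<Longrightarrow> ev2 q0 t 1 + mu * ev2 q1 t 1 \<noteq> 0"
    using avoid_zeros[of "{t. poly (dehom p) t = 0}" "\<lambda>t. ev2 q0 t 1" "\<lambda>t. ev2 q1 t 1"] by auto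
  define q where "q = q0 + Polynomial.smult [:mu:] q1"
  have hq: "homogeneous2 e q" unfolding q_def by (rule hom[OF q])
  have "det (sylvester_mat_sub d e (dehom p) (dehom q)) \<noteq> 0"
  proof (rule det_sylvester_nonzero)
    show "poly (dehom q) x \<noteq> 0" if "poly (dehom p) x = 0" for x
      using mu[OF that] by (simp add: q_def flip: ev2_dehom)
  qed (use cd degree_dehom_le hp hq in auto)
  then show thesis using that[of lam mu] by (simp add: Res_tv_def p_def q_def dehom_def)
qed

section \<open>The cone structure of the image\<close>

lemma ev2_eq_imp:
  fixes p q :: "'a::field_char_0 bipoly"
  assumes "\<And>t v. ev2 p t v = ev2 q t v"
  shows "p = q"
  using ev2_eq_0_imp[of "p - q"] assms by simp

lemma homogeneous2_0_const:
  assumes "homogeneous2 0 p"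
  shows "p = [:[:coeff (coeff p 0) 0:]:]"
proof (intro poly_eqI)
  fix i j
  show "coeff (coeff p i) j = coeff (coeff [:[:coeff (coeff p 0) 0:]:] i) j"
    using assms unfolding homogeneous2_def
    by (cases i; cases j) (auto simp: coeff_pCons split: nat.splits)
qed

lemma ev2_origin: "homogeneous2 d p \<Longrightarrow> d > 0 \<Longrightarrow> ev2 p 0 0 = 0"
  using homogeneous2_ev2[of d p 0 0 0] by (simp add: power_0_left)

section \<open>Two-dimensional span and constant syzygies\<close>

text \<open>The nonzero entry f_0 extends to a basis of the span chosen among the entries; its
  second member is f_j.\<close>

lemma dim_span_2_basis:
  fixes f :: "'a::field bipoly vec"
  assumes f: "f \<in> carrier_vec 4" "f $ 0 \<noteq> 0" and dim: "dim_span f = 2"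
  obtains j \<alpha> \<beta> where "j \<in> {1, 2, 3}"
    "\<And>i. i < 4 \<Longrightarrow> f $ i = Polynomial.smult [:\<alpha> i:] (f $ 0) + Polynomial.smult [:\<beta> i:] (f $ j)"
    "\<And>c d. Polynomial.smult [:c:] (f $ 0) + Polynomial.smult [:d:] (f $ j) = 0 \<Longrightarrow> c = 0 \<and> d = 0"
proof -
  interpret vs: vector_space "\<lambda>c :: 'a. Polynomial.smult [:c:] :: 'a bipoly \<Rightarrow> _"
  proof
    fix a b :: 'a and x y :: "'a bipoly"
    have "[:a + b:] = [:a:] + [:b:]" by simp
    then show "Polynomial.smult [:a + b:] x = Polynomial.smult [:a:] x + Polynomial.smult [:b:] x"
      by (simp only: smult_add_left)
  qed (simp_all add: smult_add_right mult.commute)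
  have f0: "f $ 0 \<in> set\<^sub>v f" using f(1) by (intro vec_setI[of _ 0]) auto
  have "vs.independent {f $ 0}" using f(2) by (simp add: vs.dependent_single)
  then obtain B where B: "{f $ 0} \<subseteq> B" "B \<subseteq> set\<^sub>v f" "vs.independent B" "set\<^sub>v f \<subseteq> vs.span B"
    using vs.maximal_independent_subset_extend[of "{f $ 0}" "set\<^sub>v f"] f0 by blast
  have "card B = 2" using vs.basis_card_eq_dim[OF B(2,4,3)] dim by (simp add: dim_span_def)
  then obtain q where q: "B = {f $ 0, q}" "q \<noteq> f $ 0" using B(1) by (auto simp: card_2_iff)
  then obtain j where j: "f $ j = q" "j < 4" using B(2) f(1) by (auto simp: vec_set_def)
  have "j \<noteq> 0" using j q by metis
  then have j123: "j \<in> {1, 2, 3}" using j by auto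
  have "q \<notin> vs.span {f $ 0}"
    using B(3) q vs.independent_insert[of q "{f $ 0}"] by (simp add: insert_commute)
  then have nq: "q \<noteq> Polynomial.smult [:c:] (f $ 0)" for c
    by (auto simp: vs.span_singleton)
  have "\<exists>c d. f $ i = Polynomial.smult [:c:] (f $ 0) + Polynomial.smult [:d:] q" if "i < 4" for i
  proof -
    have "f $ i \<in> set\<^sub>v f" using that f(1) by (auto simp: vec_set_def)
    then have "f $ i \<in> vs.span (insert (f $ 0) {q})" using B(4) q(1) by blast
    then obtain c d where "f $ i - Polynomial.smult [:c:] (f $ 0) = Polynomial.smult [:d:] q"
      unfolding vs.span_insert[of "f $ 0"] vs.span_singleton by blast
    then show ?thesis by (metis add.commute diff_add_cancel)
  qed
  then obtain \<alpha> \<beta> where ab: "\<And>i. i < 4 \<Longrightarrow> f $ i = Polynomial.smult [:\<alpha> i:] (f $ 0) + Polynomial.smult [:\<beta> i:] q"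
    by metis
  have ind: "c = 0 \<and> d = 0" if e: "Polynomial.smult [:c:] (f $ 0) + Polynomial.smult [:d:] q = 0" for c d
  proof -
    have "d = 0"
    proof (rule ccontr)
      assume "d \<noteq> 0"
      have "q = Polynomial.smult [:1 / d:] (Polynomial.smult [:d:] q)" using \<open>d \<noteq> 0\<close> by simp
      also have "Polynomial.smult [:d:] q = - Polynomial.smult [:c:] (f $ 0)"
        using e by (simp add: add_eq_0_iff2 add.commute)
      finally have "q = Polynomial.smult [:- c / d:] (f $ 0)" by simp
      then show False using nq by blast
    qed
    then show ?thesis using e f(2) by simp
  qed
  show thesis
  proof (rule that[OF j123])
    show "f $ i = Polynomial.smult [:\<alpha> i:] (f $ 0) + Polynomial.smult [:\<beta> i:] (f $ j)" if "i < 4" for i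
      unfolding j(1) by (rule ab[OF that])
    show "c = 0 \<and> d = 0" if "Polynomial.smult [:c:] (f $ 0) + Polynomial.smult [:d:] (f $ j) = 0" for c d
      by (rule ind) (use that j(1) in simp)
  qed
qed

text \<open>The form x q - y p has a nontrivial zero, at which (p, q) is a nonzero multiple of (x,
  y); an \<open>m\<close>-th root rescales it to the exact value.\<close>

lemma binary_pair_onto:
  fixes p q :: "'a::{alg_closed_field, field_char_0} bipoly"
  assumes m: "m \<ge> 1" and p: "homogeneous2 m p" and q: "homogeneous2 m q"
    and cop: "\<And>s u. (s, u) \<noteq> (0, 0) \<Longrightarrow> ev2 p s u \<noteq> 0 \<or> ev2 q s u \<noteq> 0" and x: "x \<noteq> 0"
  obtains s u where "(s, u) \<noteq> (0, 0)" "ev2 p s u = x" "ev2 q s u = y"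
proof -
  have "homogeneous2 m (Polynomial.smult [:x:] q - Polynomial.smult [:y:] p)"
    by (intro homogeneous2_diff homogeneous2_smult p q)
  then obtain s u where su: "(s, u) \<noteq> (0, 0)" "ev2 (Polynomial.smult [:x:] q - Polynomial.smult [:y:] p) s u = 0"
    using exists_binary_zero[OF _ m] by blast
  then have e: "x * ev2 q s u = y * ev2 p s u" by simp
  have p0: "ev2 p s u \<noteq> 0" using cop[OF su(1)] e x by auto
  obtain c where c: "c ^ m = x / ev2 p s u" using nth_root_exists[of m "x / ev2 p s u"] m by auto
  have "c \<noteq> 0" using c x p0 m by (auto simp: power_0_left)
  show thesis
  proof (rule that[of "c * s" "c * u"])
    show "(c * s, c * u) \<noteq> (0, 0)" using su(1) \<open>c \<noteq> 0\<close> by auto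
    show "ev2 p (c * s) (c * u) = x" using p0 by (simp add: homogeneous2_ev2[OF p] c)
    have "ev2 q (c * s) (c * u) = (x * ev2 q s u) / ev2 p s u" by (simp add: homogeneous2_ev2[OF q] c)
    also have "\<dots> = y" unfolding e using p0 by simp
    finally show "ev2 q (c * s) (c * u) = y" .
  qed
qed

text \<open>If \<mu>2 were positive, \<open>b\<close> and \<open>c\<close> would vanish at the
  origin, and every syzygy evaluated there would be a multiple of \<open>a\<close>. The constant
  syzygies expressing f_k and f_l through f_0 and f_j are linearly independent, however.\<close>

lemma syzygy_degrees_zero:
  fixes f a b c :: "'a::field bipoly vec"
  assumes f: "f \<in> carrier_vec 4" and basis: "is_syz_basis f a b c"
    and b: "\<And>i. i < 4 \<Longrightarrow> homogeneous2 \<mu>2 (b $ i)" and c: "\<And>i. i < 4 \<Longrightarrow> homogeneous2 \<mu>3 (c $ i)"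
    and le: "\<mu>2 \<le> \<mu>3"
    and idx: "{..<4} = {0, j, k, l}" "j \<noteq> 0" "k \<noteq> 0" "l \<noteq> 0" "j \<noteq> k" "j \<noteq> l" "k \<noteq> l"
    and dec: "\<And>i. i < 4 \<Longrightarrow> f $ i = Polynomial.smult [:\<alpha> i:] (f $ 0) + Polynomial.smult [:\<beta> i:] (f $ j)"
  shows "\<mu>2 = 0"
proof (rule ccontr)
  assume "\<mu>2 \<noteq> 0"
  have less: "j < 4" "k < 4" "l < 4" using idx(1) by (metis insertI1 insertI2 lessThan_iff)+
  have car: "a \<in> carrier_vec 4" "b \<in> carrier_vec 4" "c \<in> carrier_vec 4"
    using basis f by (auto simp: is_syz_basis_def syz_def)
  have neg: "Polynomial.smult [:- z:] p = - Polynomial.smult [:z:] p" for z :: 'a and p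
    using smult_minus_left[of "[:z:]" p] by simp
  define \<kappa> where "\<kappa> r = vec 4 (\<lambda>i. if i = r then 1 else if i = 0 then [:[:- \<alpha> r:]:] else if i = j then [:[:- \<beta> r:]:] else (0 :: 'a bipoly))" for r
  have ex: "\<exists>x. \<forall>i<4. ev2 (\<kappa> r $ i) 0 0 = x * ev2 (a $ i) 0 0" if r: "r \<in> {k, l}" for r
  proof -
    have r4: "r < 4" "r \<noteq> 0" "r \<noteq> j" using r less idx(2-7) by auto
    have "f \<bullet> \<kappa> r = (\<Sum>i\<in>{0, j, k, l}. f $ i * \<kappa> r $ i)"
      unfolding idx(1)[symmetric] by (simp add: scalar_prod_def \<kappa>_def lessThan_atLeast0)
    also have "\<dots> = f $ r - Polynomial.smult [:\<alpha> r:] (f $ 0) - Polynomial.smult [:\<beta> r:] (f $ j)"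
      using r idx(2-7) less by (elim insertE emptyE) (simp_all add: \<kappa>_def neg)
    also have "\<dots> = 0" using dec[OF r4(1)] by simp
    finally have "\<kappa> r \<in> syz f" using f by (simp add: syz_def \<kappa>_def)
    then obtain x y z where xyz: "\<kappa> r = x \<cdot>\<^sub>v a + y \<cdot>\<^sub>v b + z \<cdot>\<^sub>v c"
      using basis unfolding is_syz_basis_def by blast
    have "ev2 (\<kappa> r $ i) 0 0 = ev2 x 0 0 * ev2 (a $ i) 0 0" if "i < 4" for i
      using car that ev2_origin[OF b[OF that]] ev2_origin[OF c[OF that]] \<open>\<mu>2 \<noteq> 0\<close> le by (simp add: xyz)
    then show ?thesis by blast
  qed
  obtain x where x: "\<forall>i<4. ev2 (\<kappa> k $ i) 0 0 = x * ev2 (a $ i) 0 0"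
    by (rule exE[OF ex[of k]]) simp
  obtain y where y: "\<forall>i<4. ev2 (\<kappa> l $ i) 0 0 = y * ev2 (a $ i) 0 0"
    by (rule exE[OF ex[of l]]) simp
  \<comment> \<open>The first two equations force entry \<open>l\<close> of \<open>a\<close> to
    vanish at the origin, against the third.\<close>
  have "x * ev2 (a $ k) 0 0 = 1" "x * ev2 (a $ l) 0 0 = 0" "y * ev2 (a $ l) 0 0 = 1"
    using x[rule_format, OF less(2)] x[rule_format, OF less(3)] y[rule_format, OF less(3)] idx(2-7) less
    by (simp_all add: \<kappa>_def)
  then show False by auto
qed

text \<open>The syzygy is expanded in the independent forms f_0 and f_j, whose coefficients vanish
  separately.\<close>

lemma constant_syzygy:
  fixes f a :: "'a::field bipoly vec"
  assumes f: "f \<in> carrier_vec 4" and a: "a \<in> carrier_vec 4" "f \<bullet> a = 0" "\<And>i. i < 4 \<Longrightarrow> a $ i = [:[:c i:]:]"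
    and dec: "\<And>i. i < 4 \<Longrightarrow> f $ i = Polynomial.smult [:\<alpha> i:] (f $ 0) + Polynomial.smult [:\<beta> i:] (f $ j)"
    and ind: "\<And>c d. Polynomial.smult [:c:] (f $ 0) + Polynomial.smult [:d:] (f $ j) = 0 \<Longrightarrow> c = 0 \<and> d = 0"
  shows "(\<Sum>i<4. c i * \<alpha> i) = 0" "(\<Sum>i<4. c i * \<beta> i) = 0"
proof -
  have cs: "[:sum h I:] = (\<Sum>i\<in>I. [:h i:])" for h :: "nat \<Rightarrow> 'a" and I
  proof (induction I rule: infinite_finite_induct)
    case (insert x F)
    have "[:sum h (insert x F):] = [:h x:] + [:sum h F:]" using insert.hyps by simp
    then show ?case using insert by simp
  qed simp_all
  have "0 = (\<Sum>i<4. Polynomial.smult [:c i:] (f $ i))"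
    using a f by (simp add: scalar_prod_def lessThan_atLeast0)
  also have "\<dots> = (\<Sum>i<4. Polynomial.smult [:c i * \<alpha> i:] (f $ 0) + Polynomial.smult [:c i * \<beta> i:] (f $ j))"
  proof (rule sum.cong)
    fix i :: nat assume "i \<in> {..<4}"
    then have "i < 4" by simp
    show "Polynomial.smult [:c i:] (f $ i) = Polynomial.smult [:c i * \<alpha> i:] (f $ 0) + Polynomial.smult [:c i * \<beta> i:] (f $ j)"
      by (subst dec[OF \<open>i < 4\<close>]) (simp add: smult_add_right mult.commute)
  qed simp
  also have "\<dots> = Polynomial.smult [:\<Sum>i<4. c i * \<alpha> i:] (f $ 0) + Polynomial.smult [:\<Sum>i<4. c i * \<beta> i:] (f $ j)"
    by (simp only: sum.distrib cs smult_sum)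
  finally show "(\<Sum>i<4. c i * \<alpha> i) = 0" "(\<Sum>i<4. c i * \<beta> i) = 0" using ind by metis+
qed

text \<open>Multiplied by \<open>D\<close>, the value is a combination of the two relations for
  \<open>c\<close>; and \<open>D\<close> is nonzero at \<open>(t, v)\<close> since it divides
  g_0.\<close>

lemma moving_plane_contains:
  fixes D \<gamma> :: "'a::field_char_0 bipoly" and g A' :: "'a bipoly vec"
  assumes "D * A' $ 0 = moving_entry g c 0" "D * \<gamma> = g $ 0"
    and A': "\<And>i. i \<in> {1, 2, 3} \<Longrightarrow> A' $ i = Polynomial.smult [:c i:] \<gamma>"
    and rel: "(\<Sum>i<4. c i * \<alpha> i) = 0" "(\<Sum>i<4. c i * \<beta> i) = 0" "\<alpha> 0 = 1" "\<beta> 0 = 0"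
    and g0: "ev2 (g $ 0) t v \<noteq> 0"
  shows "ev2 (x_eval A' (cone_point (\<lambda>i. g $ i + Polynomial.smult [:\<alpha> i:] (g $ 0)) \<beta> x y t v)) t v = 0"
proof -
  define P where "P = cone_point (\<lambda>i. g $ i + Polynomial.smult [:\<alpha> i:] (g $ 0)) \<beta> x y t v"
  let ?g = "\<lambda>i. ev2 (g $ i) t v"
  have P: "P i = x * (?g i + \<alpha> i * ?g 0) + y * \<beta> i" for i by (simp add: P_def cone_point_def)
  have D0: "ev2 D t v * ev2 (A' $ 0) t v = 1 / 2 * (c 0 * ?g 0 - (c 1 * ?g 1 + c 2 * ?g 2 + c 3 * ?g 3))"
    unfolding ev2_hom(6)[symmetric] assms(1) by (simp add: moving_entry_def)
  have D\<gamma>: "ev2 D t v * ev2 \<gamma> t v = ?g 0" unfolding ev2_hom(6)[symmetric] assms(2) ..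
  have "ev2 (x_eval A' P) t v = P 0 * ev2 (A' $ 0) t v + (P 1 * c 1 + P 2 * c 2 + P 3 * c 3) * ev2 \<gamma> t v"
    using A'[of 1] A'[of 2] A'[of 3] by (simp add: x_eval_def lessThan_4 algebra_simps)
  then have "ev2 D t v * ev2 (x_eval A' P) t v
      = P 0 * (ev2 D t v * ev2 (A' $ 0) t v) + (P 1 * c 1 + P 2 * c 2 + P 3 * c 3) * (ev2 D t v * ev2 \<gamma> t v)"
    by (simp add: algebra_simps)
  also have "\<dots> = P 0 * (1 / 2 * (c 0 * ?g 0 - (c 1 * ?g 1 + c 2 * ?g 2 + c 3 * ?g 3))) + (P 1 * c 1 + P 2 * c 2 + P 3 * c 3) * ?g 0"
    unfolding D0 D\<gamma> ..
  \<comment> \<open>Coordinate 0 of the cone point is 2 x g_0; the factor 1/2 compensates the 2, and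
    the terms in g_1, g_2, g_3 cancel.\<close>
  also have "\<dots> = x * ?g 0 * ?g 0 * (c 0 * \<alpha> 0 + c 1 * \<alpha> 1 + c 2 * \<alpha> 2 + c 3 * \<alpha> 3)
      + y * ?g 0 * (c 0 * \<beta> 0 + c 1 * \<beta> 1 + c 2 * \<beta> 2 + c 3 * \<beta> 3)"
    unfolding P rel(3,4) by (simp add: algebra_simps)
  also have "\<dots> = 0" using rel(1,2) by (simp add: lessThan_4 add.assoc)
  finally have "ev2 D t v * ev2 (x_eval A' P) t v = 0" .
  moreover have "ev2 D t v \<noteq> 0" using D\<gamma> g0 by auto
  ultimately show ?thesis by (simp add: P_def)
qed

text \<open>The two hypotheses on \<open>G\<close> are two independent linear equations valid on the
  whole cone, so its closure lies in a line.\<close>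

lemma degenerate_cone_in_line:
  fixes G :: "nat \<Rightarrow> 'a::field_char_0 bipoly"
  assumes idx: "{..<4} = {0, j, k, l}" "j \<noteq> 0" "k \<noteq> 0" "l \<noteq> 0" "j \<noteq> k" "j \<noteq> l" "k \<noteq> l"
    and \<beta>: "\<beta> 0 = 0" "\<beta> j = 1"
    and k: "G k - Polynomial.smult [:\<beta> k:] (G j) = Polynomial.smult [:ek:] (G 0)"
    and l: "G l - Polynomial.smult [:\<beta> l:] (G j) = Polynomial.smult [:el:] (G 0)"
    and X: "\<And>x. x \<in> X \<Longrightarrow> \<exists>a b t v. x = proj_point (vec 4 (cone_point G \<beta> a b t v)) \<and> vec 4 (cone_point G \<beta> a b t v) \<noteq> 0\<^sub>v 4"
  shows "zariski_dim (zariski_closure X) \<noteq> 2"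
proof -
  have less: "j < 4" "k < 4" "l < 4" using idx(1) by (metis insertI1 insertI2 lessThan_iff)+
  define c where "c r i = (if i = r then 1 else if i = j then - \<beta> r else if i = 0 then (if r = k then - ek else - el) else 0)" for r i
  define L where "L = {proj_point p | p. p \<in> carrier_vec 4 \<and> p \<noteq> 0\<^sub>v 4 \<and> (\<forall>r\<in>{k, l}. (\<Sum>i<4. c r i * p $ i) = 0)}"
  have lin: "(\<forall>r\<in>{k, l}. (\<Sum>i<4. c r i * P i) = 0) \<longleftrightarrow> P k = \<beta> k * P j + ek * P 0 \<and> P l = \<beta> l * P j + el * P 0"
    for P :: "nat \<Rightarrow> 'a"
  proof -
    have "(\<Sum>i<4. c k i * P i) = P k - (\<beta> k * P j + ek * P 0)" "(\<Sum>i<4. c l i * P i) = P l - (\<beta> l * P j + el * P 0)"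
      unfolding idx(1) using idx(2-7) by (simp_all add: c_def)
    then show ?thesis by simp
  qed
  have "X \<subseteq> L"
  proof
    fix x assume "x \<in> X"
    then obtain a b t v where x: "x = proj_point (vec 4 (cone_point G \<beta> a b t v))" "vec 4 (cone_point G \<beta> a b t v) \<noteq> 0\<^sub>v 4"
      using X by blast
    have "ev2 (G k) t v - \<beta> k * ev2 (G j) t v = ek * ev2 (G 0) t v"
      "ev2 (G l) t v - \<beta> l * ev2 (G j) t v = el * ev2 (G 0) t v"
      using arg_cong[OF k, of "\<lambda>p. ev2 p t v"] arg_cong[OF l, of "\<lambda>p. ev2 p t v"] by simp_all
    then have "ev2 (G k) t v = \<beta> k * ev2 (G j) t v + ek * ev2 (G 0) t v"
      "ev2 (G l) t v = \<beta> l * ev2 (G j) t v + el * ev2 (G 0) t v" by (simp_all add: algebra_simps)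
    then have "\<forall>r\<in>{k, l}. (\<Sum>i<4. c r i * vec 4 (cone_point G \<beta> a b t v) $ i) = 0"
      using less unfolding lin by (simp add: cone_point_def \<beta> algebra_simps)
    then show "x \<in> L" unfolding L_def using x by (blast intro: vec_carrier)
  qed
  moreover have "zariski_closed L" unfolding L_def by (rule zariski_closed_linear)
  ultimately have cl: "zariski_closure X \<subseteq> L" unfolding zariski_closure_def by blast
  \<comment> \<open>The point of that line with coordinate 0 equal to 1 and coordinate
    \<open>j\<close> equal to 0; together with the vertex it spans the line.\<close>
  define u where "u = (\<lambda>i. if i = 0 then 1 else if i = k then ek else if i = l then el else 0)"
  show ?thesis
  proof (rule zariski_dim_line[where u = u and w = \<beta>])
    fix y assume "y \<in> zariski_closure X"
    then obtain p where p: "y = proj_point p" "p \<in> carrier_vec 4" "p \<noteq> 0\<^sub>v 4" "\<forall>r\<in>{k, l}. (\<Sum>i<4. c r i * p $ i) = 0"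
      using cl by (auto simp: L_def)
    have pk: "p $ k = \<beta> k * p $ j + ek * p $ 0" "p $ l = \<beta> l * p $ j + el * p $ 0" using p(4) unfolding lin by auto
    have "p = vec 4 (\<lambda>i. p $ 0 * u i + p $ j * \<beta> i)"
    proof (rule eq_vecI)
      fix i assume "i < dim_vec (vec 4 (\<lambda>i. p $ 0 * u i + p $ j * \<beta> i))"
      then have "i < 4" by simp
      moreover have "i = 0 \<or> i = j \<or> i = k \<or> i = l" using \<open>i < 4\<close> idx(1) by blast
      ultimately show "p $ i = vec 4 (\<lambda>i. p $ 0 * u i + p $ j * \<beta> i) $ i"
        using idx(2-7) pk \<beta> by (auto simp: u_def)
    qed (use p in simp)
    then show "\<exists>a b. vec 4 (\<lambda>i. a * u i + b * \<beta> i) \<noteq> 0\<^sub>v 4 \<and> y = proj_point (vec 4 (\<lambda>i. a * u i + b * \<beta> i))"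
      using p by metis
  qed
qed

text \<open>The zero syzygy has only one expansion in the basis.\<close>

lemma syzygies_independent:
  fixes f a b c :: "'a::field bipoly vec"
  assumes basis: "is_syz_basis f a b c" and f: "f \<in> carrier_vec 4"
    and ca: "\<And>i. i < 4 \<Longrightarrow> a $ i = [:[:ca i:]:]" and cb: "\<And>i. i < 4 \<Longrightarrow> b $ i = [:[:cb i:]:]"
    and z: "\<And>i. i < 4 \<Longrightarrow> x * ca i + y * cb i = 0"
  shows "x = 0 \<and> y = 0"
proof -
  have car: "a \<in> carrier_vec 4" "b \<in> carrier_vec 4" "c \<in> carrier_vec 4"
    using basis f by (auto simp: is_syz_basis_def syz_def)
  have "0\<^sub>v 4 \<in> syz f" using f by (simp add: syz_def)
  then have ex1: "\<exists>!(\<alpha>, \<beta>, \<gamma>). 0\<^sub>v 4 = \<alpha> \<cdot>\<^sub>v a + \<beta> \<cdot>\<^sub>v b + \<gamma> \<cdot>\<^sub>v c"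
    using basis by (simp add: is_syz_basis_def)
  have 1: "0\<^sub>v 4 = 0 \<cdot>\<^sub>v a + 0 \<cdot>\<^sub>v b + 0 \<cdot>\<^sub>v c"
    by (rule eq_vecI) (use car in auto)
  have 2: "0\<^sub>v 4 = [:[:x:]:] \<cdot>\<^sub>v a + [:[:y:]:] \<cdot>\<^sub>v b + 0 \<cdot>\<^sub>v c"
    by (rule eq_vecI) (use car z in \<open>auto simp: ca cb\<close>)
  from ex1 obtain t where t: "\<And>s. (case s of (\<alpha>, \<beta>, \<gamma>) \<Rightarrow> 0\<^sub>v 4 = \<alpha> \<cdot>\<^sub>v a + \<beta> \<cdot>\<^sub>v b + \<gamma> \<cdot>\<^sub>v c) \<Longrightarrow> s = t"
    by (elim ex1E) blast
  have "(0, 0, 0) = t" by (rule t) (simp only: prod.case, rule 1)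
  moreover have "([:[:x:]:], [:[:y:]:], 0) = t" by (rule t) (simp only: prod.case, rule 2)
  ultimately have "([:[:x:]:], [:[:y:]:], 0 :: 'a bipoly) = (0, 0, 0)" by simp
  then show ?thesis by simp
qed

text \<open>A vector orthogonal to \<alpha> and \<beta> is determined by its entries
  \<open>k\<close> and \<open>l\<close>, so independence of \<open>ca\<close> and \<open>cb\<close>
  is visible in these two entries.\<close>

lemma syzygy_minor_nonzero:
  fixes ca cb \<alpha> \<beta> :: "nat \<Rightarrow> 'a::field"
  assumes idx: "{..<4} = {0, j, k, l}" "j \<noteq> 0" "k \<noteq> 0" "l \<noteq> 0" "j \<noteq> k" "j \<noteq> l" "k \<noteq> l"
    and ind: "\<And>x y. (\<And>i. i < 4 \<Longrightarrow> x * ca i + y * cb i = 0) \<Longrightarrow> x = 0 \<and> y = 0"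
    and \<alpha>: "\<alpha> 0 = 1" and \<beta>: "\<beta> 0 = 0" "\<beta> j = 1"
    and ra: "(\<Sum>i<4. ca i * \<alpha> i) = 0" "(\<Sum>i<4. ca i * \<beta> i) = 0"
    and rb: "(\<Sum>i<4. cb i * \<alpha> i) = 0" "(\<Sum>i<4. cb i * \<beta> i) = 0"
  shows "ca k * cb l - ca l * cb k \<noteq> 0"
proof
  assume det: "ca k * cb l - ca l * cb k = 0"
  have all: "x * ca i + y * cb i = 0" if i: "i < 4" and k: "x * ca k + y * cb k = 0" and l: "x * ca l + y * cb l = 0" for x y i
  proof -
    define w where "w i = x * ca i + y * cb i" for i
    have s: "(\<Sum>i<4. w i * \<epsilon> i) = x * (\<Sum>i<4. ca i * \<epsilon> i) + y * (\<Sum>i<4. cb i * \<epsilon> i)" for \<epsilon>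
      by (simp add: w_def sum_distrib_left sum.distrib algebra_simps)
    have wk: "w k = 0" "w l = 0" using k l by (simp_all add: w_def)
    have "(\<Sum>i<4. w i * \<beta> i) = 0" unfolding s ra rb by simp
    then have wj: "w j = 0" unfolding idx(1) using idx(2-7) wk \<beta> by simp
    have "(\<Sum>i<4. w i * \<alpha> i) = 0" unfolding s ra rb by simp
    then have w0: "w 0 = 0" unfolding idx(1) using idx(2-7) wk wj \<alpha> by simp
    have "i \<in> {0, j, k, l}" using i idx(1) by blast
    then have "w i = 0" using w0 wj wk by blast
    then show ?thesis by (simp add: w_def)
  qed
  \<comment> \<open>With the weights \<open>cb k\<close> and \<open>- ca k\<close> the combination
    vanishes at \<open>k\<close> identically and at \<open>l\<close> by the vanishing minor.\<close>
  have zk: "cb k = 0 \<and> - ca k = 0"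
    by (rule ind, rule all) (use det in \<open>simp_all add: algebra_simps\<close>)
  have zl: "cb l = 0 \<and> - ca l = 0"
    by (rule ind, rule all) (use det in \<open>simp_all add: algebra_simps\<close>)
  have "(1::'a) = 0 \<and> (0::'a) = 0"
    by (rule ind, rule all) (use zk zl in simp_all)
  then show False by simp
qed

text \<open>A moving plane of degree 0 forces a linear relation on the curve, so that two of them make the cone a line.\<close>

lemma degree_0_moving_plane:
  fixes g :: "'a::field_char_0 bipoly vec" and \<alpha> \<beta> c :: "nat \<Rightarrow> 'a"
  defines "G \<equiv> \<lambda>i. g $ i + Polynomial.smult [:\<alpha> i:] (g $ 0)"
  assumes idx: "{..<4} = {0, j, k, l}" "j \<noteq> 0" "k \<noteq> 0" "l \<noteq> 0" "j \<noteq> k" "j \<noteq> l" "k \<noteq> l"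
    and \<beta>0: "\<beta> 0 = 0" and \<beta>j: "\<beta> j = 1" and g0: "g $ 0 \<noteq> 0"
    and C: "homogeneous2 0 C0" "homogeneous2 0 \<eta>" "Q * \<eta> = g $ 0" "Q * C0 = moving_entry g c 0"
    and r: "(\<Sum>i<4. c i * \<beta> i) = 0"
  shows "\<exists>z. \<forall>t v. c k * (ev2 (G k) t v - \<beta> k * ev2 (G j) t v) + c l * (ev2 (G l) t v - \<beta> l * ev2 (G j) t v)
    = z * ev2 (g $ 0) t v"
proof -
  obtain p q where pq: "C0 = [:[:p:]:]" "\<eta> = [:[:q:]:]" using homogeneous2_0_const C by blast
  have "q \<noteq> 0" using C(3) g0 pq by auto
  \<comment> \<open>With both forms constant, \<open>Q\<close> is a multiple of g_0, and the
    equation for entry 0 becomes a linear relation among the g_i.\<close>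
  have z: "c 1 * ev2 (g $ 1) t v + c 2 * ev2 (g $ 2) t v + c 3 * ev2 (g $ 3) t v = (c 0 - 2 * p / q) * ev2 (g $ 0) t v" for t v
  proof -
    have 1: "ev2 Q t v * q = ev2 (g $ 0) t v" using arg_cong[OF C(3), of "\<lambda>p. ev2 p t v"] by (simp only: pq ev2_hom)
    have 2: "ev2 Q t v * p = 1 / 2 * (c 0 * ev2 (g $ 0) t v - (c 1 * ev2 (g $ 1) t v + c 2 * ev2 (g $ 2) t v + c 3 * ev2 (g $ 3) t v))"
      using arg_cong[OF C(4), of "\<lambda>p. ev2 p t v"] by (simp only: pq ev2_hom) (simp add: moving_entry_def)
    have "2 * p / q * ev2 (g $ 0) t v = 2 * (ev2 Q t v * p)" unfolding 1[symmetric] using \<open>q \<noteq> 0\<close> by simp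
    then show ?thesis unfolding 2 by (simp add: algebra_simps)
  qed
  let ?h = "\<lambda>i t v. c i * ev2 (g $ i) t v"
  have jkl: "{1, 2, 3} = {j, k, l}"
  proof -
    have "{1, 2, 3} = {..<4::nat} - {0}" by auto
    also have "\<dots> = {j, k, l}" unfolding idx(1) using idx(2-7) by auto
    finally show ?thesis .
  qed
  have "?h j t v + ?h k t v + ?h l t v = (c 0 - 2 * p / q) * ev2 (g $ 0) t v" for t v
  proof -
    have "(\<Sum>i\<in>{1, 2, 3}. ?h i t v) = (c 0 - 2 * p / q) * ev2 (g $ 0) t v"
      using z[of t v] by (simp add: add.assoc)
    then show ?thesis unfolding jkl using idx(2-7) by (simp add: add.assoc)
  qed
  \<comment> \<open>Orthogonality to the vertex eliminates \<open>c j\<close>; passing from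
    \<open>g\<close> to \<open>G\<close> afterwards changes the relation only by multiples of
    g_0.\<close>
  moreover have "c j + (c k * \<beta> k + c l * \<beta> l) = 0"
    using r unfolding idx(1) using idx(2-7) \<beta>0 \<beta>j by simp
  then have "c j = - (c k * \<beta> k + c l * \<beta> l)" by (simp only: eq_neg_iff_add_eq_0)
  ultimately have "c k * (ev2 (g $ k) t v - \<beta> k * ev2 (g $ j) t v) + c l * (ev2 (g $ l) t v - \<beta> l * ev2 (g $ j) t v)
      = (c 0 - 2 * p / q) * ev2 (g $ 0) t v" for t v
    by (simp add: algebra_simps)
  then have "c k * (ev2 (G k) t v - \<beta> k * ev2 (G j) t v) + c l * (ev2 (G l) t v - \<beta> l * ev2 (G j) t v)
      = (c 0 - 2 * p / q + c k * (\<alpha> k - \<beta> k * \<alpha> j) + c l * (\<alpha> l - \<beta> l * \<alpha> j)) * ev2 (g $ 0) t v" for t v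
    by (simp add: G_def algebra_simps)
  then show ?thesis by blast
qed

lemma rational_image_h_vec:
  "map_vec (\<lambda>q. eval4 q (vec_of_list [s, u, t, v])) (h_vec f g)
    = vec 4 (\<lambda>i. ev2 (f $ 0) s u * ev2 (g $ i) t v + ev2 (f $ i) s u * ev2 (g $ 0) t v)"
  by (rule eq_vecI) (simp_all add: h_vec_def eval4_eq_ev4 numeral_2_eq_2 numeral_3_eq_3)

text \<open>\<open>A\<close> and \<open>B\<close> have entries in the four-variable ring, so they
  are first exhibited as images of vectors over \<open>K[t,v]\<close>; \<open>d\<close> and
  \<open>e\<close> are the degrees for which the Sylvester matrix is formed.\<close>

theorem proposition4p4:
  fixes f g a b c :: "'a::{alg_closed_field, field_char_0} bipoly vec"
    and m n \<mu>1 \<mu>2 \<mu>3 :: nat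
    and dA dB :: "'a quadpoly" and A B :: "'a quadpoly vec"
  assumes "m \<ge> 1" and "n \<ge> 1"
    and "f \<in> carrier_vec 4" and "\<forall>i<4. homogeneous2 m (f $ i)"
    and "g \<in> carrier_vec 4" and "\<forall>i<4. homogeneous2 n (g $ i)"
    and "is_gcd_set 1 (set\<^sub>v f)" and "is_gcd_set 1 (set\<^sub>v g)"
    and "f $ 0 \<noteq> 0" and "g $ 0 \<noteq> 0"
    and surface: "zariski_dim (zariski_closure (rational_image (h_vec f g))) = 2"
    and basis: "is_syz_basis f a b c"
    and "\<forall>i<4. homogeneous2 \<mu>1 (a $ i)"
    and "\<forall>i<4. homogeneous2 \<mu>2 (b $ i)"
    and "\<forall>i<4. homogeneous2 \<mu>3 (c $ i)"
    and "\<mu>1 \<le> \<mu>2" and "\<mu>2 \<le> \<mu>3" and "\<mu>1 + \<mu>2 + \<mu>3 = m"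
    and "is_gcd_set dA (set\<^sub>v (N_mult g a))" and "N_mult g a = dA \<cdot>\<^sub>v A"
    and "is_gcd_set dB (set\<^sub>v (N_mult g b))" and "N_mult g b = dB \<cdot>\<^sub>v B"
    and dim2: "dim_span f = 2"
  shows "\<exists>A' B' d e. A = map_vec tv_to_R A' \<and> B = map_vec tv_to_R B' \<and>
           homogeneous2 d (x_mult A') \<and> homogeneous2 e (x_mult B') \<and>
           Res_tv d e (x_mult A') (x_mult B') \<noteq> 0 \<and>
           (\<exists>E F. Res_tv d e (x_mult A') (x_mult B') = E * F \<and>
                  is_implicit_equation F (rational_image (h_vec f g)))"
proof -
  note m = \<open>m \<ge> 1\<close> and n = \<open>n \<ge> 1\<close> and f = \<open>f \<in> carrier_vec 4\<close> and g = \<open>g \<in> carrier_vec 4\<close>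
    and f0 = \<open>f $ 0 \<noteq> 0\<close> and g0 = \<open>g $ 0 \<noteq> 0\<close>
  have homf: "homogeneous2 m (f $ i)" and homg: "homogeneous2 n (g $ i)" if "i < 4" for i
    using assms(4,6) that by auto

  \<comment> \<open>Parametrisation of the image as a cone\<close>
  obtain j \<alpha> \<beta> where j: "j \<in> {1, 2, 3}"
    and dec: "\<And>i. i < 4 \<Longrightarrow> f $ i = Polynomial.smult [:\<alpha> i:] (f $ 0) + Polynomial.smult [:\<beta> i:] (f $ j)"
    and ind: "\<And>c d. Polynomial.smult [:c:] (f $ 0) + Polynomial.smult [:d:] (f $ j) = 0 \<Longrightarrow> c = 0 \<and> d = 0"
    using dim_span_2_basis[OF f f0 dim2] by blast
  have j4: "j < 4" "j \<noteq> 0" using j by auto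
  have ev_dec: "ev2 (f $ i) s u = \<alpha> i * ev2 (f $ 0) s u + \<beta> i * ev2 (f $ j) s u" if "i < 4" for i s u
    by (subst dec[OF that]) simp
  \<comment> \<open>The expansions of f_0 and f_j in themselves are unique, which fixes the entries
    of \<alpha> and \<beta> at 0 and \<open>j\<close>.\<close>
  have ab0: "\<alpha> 0 - 1 = 0 \<and> \<beta> 0 = 0"
    by (rule ind, rule ev2_eq_imp) (use ev_dec[of 0] in \<open>simp add: algebra_simps\<close>)
  have abj: "\<alpha> j = 0 \<and> \<beta> j - 1 = 0"
    by (rule ind, rule ev2_eq_imp) (use ev_dec[OF j4(1)] in \<open>simp add: algebra_simps\<close>)
  have \<alpha>0: "\<alpha> 0 = 1" and \<beta>0: "\<beta> 0 = 0" and \<beta>j: "\<beta> j = 1" using ab0 abj by auto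
  \<comment> \<open>A common zero of f_0 and f_j is one of all f_i and would yield a common linear
    factor, against gcd 1.\<close>
  have cop: "ev2 (f $ 0) s u \<noteq> 0 \<or> ev2 (f $ j) s u \<noteq> 0" if su: "(s, u) \<noteq> (0, 0)" for s u
  proof (rule ccontr)
    assume "\<not> ?thesis"
    then have "ev2 (f $ i) s u = 0" if "i < 4" for i using ev_dec[OF that] by simp
    then have "[:[:0, - s:], [:u:]:] dvd f $ i" if "i < 4" for i
      using linear_form_dvd[OF homf[OF that] _ su] that by blast
    then have "\<forall>x\<in>set\<^sub>v f. [:[:0, - s:], [:u:]:] dvd x" using f by (auto simp: vec_set_def)
    then have "is_unit [:[:0, - s:], [:u:]:]" using \<open>is_gcd_set 1 (set\<^sub>v f)\<close> by (simp add: is_gcd_set_def)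
    then show False using linear_form_not_unit[OF su] by blast
  qed
  define G where "G = (\<lambda>i. g $ i + Polynomial.smult [:\<alpha> i:] (g $ 0))"
  have homG: "homogeneous2 n (G i)" if "i < 4" for i
    unfolding G_def using that by (intro homogeneous2_add homogeneous2_smult homg) auto
  have evG0: "ev2 (G 0) t v = 2 * ev2 (g $ 0) t v" for t v
    by (simp only: G_def \<alpha>0 ev2_hom) simp
  have G0nz: "G 0 \<noteq> 0"
  proof
    assume "G 0 = 0"
    then have "ev2 (g $ 0) t v = 0" for t v using evG0[of t v] by simp
    then show False using g0 ev2_eq_0_imp by blast
  qed
  have img: "map_vec (\<lambda>q. eval4 q (vec_of_list [s, u, t, v])) (h_vec f g)
      = vec 4 (cone_point G \<beta> (ev2 (f $ 0) s u) (ev2 (f $ j) s u * ev2 (g $ 0) t v) t v)" for s u t v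
    unfolding rational_image_h_vec
  proof (rule eq_vecI)
    let ?c = "cone_point G \<beta> (ev2 (f $ 0) s u) (ev2 (f $ j) s u * ev2 (g $ 0) t v) t v"
    let ?h = "\<lambda>i. ev2 (f $ 0) s u * ev2 (g $ i) t v + ev2 (f $ i) s u * ev2 (g $ 0) t v"
    fix i assume "i < dim_vec (vec 4 ?c)"
    then have i: "i < 4" by simp
    have "?h i = ?c i"
      by (subst ev_dec[OF i]) (simp add: cone_point_def G_def algebra_simps)
    then show "vec 4 ?h $ i = vec 4 ?c $ i" using i by simp
  qed simp

  \<comment> \<open>Choice of the coordinate to project along\<close>
  \<comment> \<open>If both conditions failed, the image would lie in a line and not be a
    surface.\<close>
  have nonconst: "(\<forall>e. G k - Polynomial.smult [:\<beta> k:] (G j) \<noteq> Polynomial.smult [:e:] (G 0))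
      \<or> (\<forall>e. G l - Polynomial.smult [:\<beta> l:] (G j) \<noteq> Polynomial.smult [:e:] (G 0))"
    if idx: "{..<4} = {0, j, k, l}" "j \<noteq> 0" "k \<noteq> 0" "l \<noteq> 0" "j \<noteq> k" "j \<noteq> l" "k \<noteq> l" for k l
  proof (rule ccontr)
    assume "\<not> ?thesis"
    then obtain ek el where e: "G k - Polynomial.smult [:\<beta> k:] (G j) = Polynomial.smult [:ek:] (G 0)"
      "G l - Polynomial.smult [:\<beta> l:] (G j) = Polynomial.smult [:el:] (G 0)" by blast
    have "zariski_dim (zariski_closure (rational_image (h_vec f g))) \<noteq> 2"
      by (rule degenerate_cone_in_line[OF idx \<beta>0 \<beta>j e]) (unfold rational_image_def img, blast)
    then show False using surface by simp
  qed
  obtain k0 l0 where idx0: "{..<4} = {0, j, k0, l0}" "j \<noteq> 0" "k0 \<noteq> 0" "l0 \<noteq> 0" "j \<noteq> k0" "j \<noteq> l0" "k0 \<noteq> l0"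
  proof -
    consider "j = 1" | "j = 2" | "j = 3" using j by blast
    then show thesis
    proof cases
      case 1 then show thesis by (intro that[of 2 3]) auto
    next
      case 2 then show thesis by (intro that[of 1 3]) auto
    next
      case 3 then show thesis by (intro that[of 1 2]) auto
    qed
  qed
  obtain k l where idx: "{..<4} = {0, j, k, l}" "j \<noteq> 0" "k \<noteq> 0" "l \<noteq> 0" "j \<noteq> k" "j \<noteq> l" "k \<noteq> l"
    and nc: "\<And>e. G k - Polynomial.smult [:\<beta> k:] (G j) \<noteq> Polynomial.smult [:e:] (G 0)"
  proof (cases "\<forall>e. G k0 - Polynomial.smult [:\<beta> k0:] (G j) \<noteq> Polynomial.smult [:e:] (G 0)")
    case True
    then show thesis using that[of k0 l0] idx0 by blast
  next
    case False
    then have "\<forall>e. G l0 - Polynomial.smult [:\<beta> l0:] (G j) \<noteq> Polynomial.smult [:e:] (G 0)"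
      using nonconst[OF idx0] by blast
    moreover have "{..<4} = {0, j, l0, k0}" using idx0(1) by (simp add: insert_commute)
    ultimately show thesis using that[of l0 k0] idx0(2-7) by metis
  qed
  interpret cone G \<beta> n j k l
    by unfold_locales (use idx homG G0nz \<beta>0 \<beta>j nc in auto)

  \<comment> \<open>Constant syzygies and reduced moving planes\<close>
  have "\<mu>2 = 0"
    by (rule syzygy_degrees_zero[OF f basis _ _ \<open>\<mu>2 \<le> \<mu>3\<close> idx, where \<alpha> = \<alpha> and \<beta> = \<beta>])
      (use assms(14,15) dec in blast)+
  then have "\<mu>1 = 0" using \<open>\<mu>1 \<le> \<mu>2\<close> by simp
  define ca where "ca i = coeff (coeff (a $ i) 0) 0" for i
  define cb where "cb i = coeff (coeff (b $ i) 0) 0" for i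
  have ca: "a $ i = [:[:ca i:]:]" and cb: "b $ i = [:[:cb i:]:]" if "i < 4" for i
    using assms(13,14) \<open>\<mu>1 = 0\<close> \<open>\<mu>2 = 0\<close> that homogeneous2_0_const unfolding ca_def cb_def by blast+
  have a: "a \<in> carrier_vec 4" "f \<bullet> a = 0" and b: "b \<in> carrier_vec 4" "f \<bullet> b = 0"
    using basis f by (auto simp: is_syz_basis_def syz_def)
  note ra = constant_syzygy[where c = ca, OF f a ca dec ind]
  note rb = constant_syzygy[where c = cb, OF f b cb dec ind]
  have det: "ca k * cb l - ca l * cb k \<noteq> 0"
    by (rule syzygy_minor_nonzero[OF idx syzygies_independent[OF basis f ca cb] \<alpha>0 \<beta>0 \<beta>j ra rb])
  have kl: "k \<in> {1, 2, 3}" "l \<in> {1, 2, 3}" using idx_less idx(3,4) by auto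
  have exa: "\<exists>r. r \<in> {1, 2, 3} \<and> ca r \<noteq> 0" and exb: "\<exists>r. r \<in> {1, 2, 3} \<and> cb r \<noteq> 0"
  proof -
    have "ca k \<noteq> 0 \<or> ca l \<noteq> 0" "cb k \<noteq> 0 \<or> cb l \<noteq> 0" using det by auto
    then show "\<exists>r. r \<in> {1, 2, 3} \<and> ca r \<noteq> 0" "\<exists>r. r \<in> {1, 2, 3} \<and> cb r \<noteq> 0" using kl by blast+
  qed
  obtain ra1 where ra1: "ra1 \<in> {1, 2, 3}" "ca ra1 \<noteq> 0" using exa by blast
  obtain rb1 where rb1: "rb1 \<in> {1, 2, 3}" "cb rb1 \<noteq> 0" using exb by blast
  obtain A' :: "'a bipoly vec" and \<gamma> D d where A': "A = map_vec tv_to_R A'" "A' \<in> carrier_vec 4"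
    "\<And>i. i < 4 \<Longrightarrow> homogeneous2 d (A' $ i)" "homogeneous2 d \<gamma>"
    "\<And>i. i \<in> {1, 2, 3} \<Longrightarrow> A' $ i = Polynomial.smult [:ca i:] \<gamma>"
    "D * \<gamma> = g $ 0" "D * A' $ 0 = moving_entry g ca 0"
    "\<And>t v. (t, v) \<noteq> (0, 0) \<Longrightarrow> ev2 (A' $ 0) t v \<noteq> 0 \<or> ev2 \<gamma> t v \<noteq> 0"
  proof (rule normalized_syzygy[where g = g and n = n and a = a and c = ca and r = ra1 and dA = dA and A = A])
    show "homogeneous2 n (g $ i)" if "i < 4" for i by (rule homg[OF that])
    show "a $ i = [:[:ca i:]:]" if "i < 4" for i by (rule ca[OF that])
  qed (rule g0 a(1) ra1(1) ra1(2) assms(19) assms(20) | (rule that; (assumption | blast)))+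
  obtain B' :: "'a bipoly vec" and \<delta> D' e where B': "B = map_vec tv_to_R B'" "B' \<in> carrier_vec 4"
    "\<And>i. i < 4 \<Longrightarrow> homogeneous2 e (B' $ i)" "homogeneous2 e \<delta>"
    "\<And>i. i \<in> {1, 2, 3} \<Longrightarrow> B' $ i = Polynomial.smult [:cb i:] \<delta>"
    "D' * \<delta> = g $ 0" "D' * B' $ 0 = moving_entry g cb 0"
    "\<And>t v. (t, v) \<noteq> (0, 0) \<Longrightarrow> ev2 (B' $ 0) t v \<noteq> 0 \<or> ev2 \<delta> t v \<noteq> 0"
  proof (rule normalized_syzygy[where g = g and n = n and a = b and c = cb and r = rb1 and dA = dB and A = B])
    show "homogeneous2 n (g $ i)" if "i < 4" for i by (rule homg[OF that])
    show "b $ i = [:[:cb i:]:]" if "i < 4" for i by (rule cb[OF that])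
  qed (rule g0 b(1) rb1(1) rb1(2) assms(21) assms(22) | (rule that; (assumption | blast)))+

  \<comment> \<open>The resultant vanishes on the cone\<close>
  define \<rho> where "\<rho> = Res_tv d e (x_mult A') (x_mult B')"
  have hom_x: "homogeneous2 d' (x_eval C P)" if "\<And>i. i < 4 \<Longrightarrow> homogeneous2 d' (C $ i)" for d' P and C :: "'a bipoly vec"
    unfolding x_eval_def lessThan_4 using that
    by (auto intro!: homogeneous2_add homogeneous2_smult)
  \<comment> \<open>For d = e = 0 the resultant would be the empty determinant 1. This case is
    excluded because two moving planes of degree 0 give two relations, solvable for the combination
    at \<open>k\<close> by the nonzero minor, against \<open>nc\<close>.\<close>
  have de: "d + e > 0"
  proof (rule ccontr)
    assume "\<not> d + e > 0"
    then have "d = 0" "e = 0" by auto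
    obtain z1 where z1: "\<And>t v. ca k * (ev2 (G k) t v - \<beta> k * ev2 (G j) t v) + ca l * (ev2 (G l) t v - \<beta> l * ev2 (G j) t v) = z1 * ev2 (g $ 0) t v"
      using degree_0_moving_plane[OF idx \<beta>0 \<beta>j g0 _ _ A'(6,7) ra(2), of \<alpha>] A'(3)[of 0] A'(4) \<open>d = 0\<close>
      unfolding G_def by auto
    obtain z2 where z2: "\<And>t v. cb k * (ev2 (G k) t v - \<beta> k * ev2 (G j) t v) + cb l * (ev2 (G l) t v - \<beta> l * ev2 (G j) t v) = z2 * ev2 (g $ 0) t v"
      using degree_0_moving_plane[OF idx \<beta>0 \<beta>j g0 _ _ B'(6,7) rb(2), of \<alpha>] B'(3)[of 0] B'(4) \<open>e = 0\<close>
      unfolding G_def by auto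
    define \<Delta> where "\<Delta> = ca k * cb l - ca l * cb k"
    \<comment> \<open>The constant comes from Cramer's rule; the 2 appears because G_0 is twice
      g_0.\<close>
    have "G k - Polynomial.smult [:\<beta> k:] (G j) = Polynomial.smult [:(cb l * z1 - ca l * z2) / (2 * \<Delta>):] (G 0)"
    proof (rule ev2_eq_imp)
      fix t v
      define X where "X = ev2 (G k) t v - \<beta> k * ev2 (G j) t v"
      define Y where "Y = ev2 (G l) t v - \<beta> l * ev2 (G j) t v"
      define W where "W = ev2 (g $ 0) t v"
      have e1: "ca k * X + ca l * Y = z1 * W" and e2: "cb k * X + cb l * Y = z2 * W"
        using z1[of t v] z2[of t v] by (simp_all add: X_def Y_def W_def)
      have "\<Delta> * X = cb l * (ca k * X + ca l * Y) - ca l * (cb k * X + cb l * Y)"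
        by (simp add: \<Delta>_def algebra_simps)
      also have "\<dots> = (cb l * z1 - ca l * z2) * W" unfolding e1 e2 by (simp add: algebra_simps)
      finally have "\<Delta> * X = (cb l * z1 - ca l * z2) * W" .
      then have "X = (cb l * z1 - ca l * z2) / \<Delta> * W"
        using det by (simp add: \<Delta>_def[symmetric] field_simps)
      then show "ev2 (G k - Polynomial.smult [:\<beta> k:] (G j)) t v = ev2 (Polynomial.smult [:(cb l * z1 - ca l * z2) / (2 * \<Delta>):] (G 0)) t v"
        by (simp add: X_def W_def evG0)
    qed
    then show False using nc by blast
  qed
  have van: "vanishes_on_cone G \<beta> \<rho>"
  proof (rule vanishes_on_cone_dense[of G, OF G0nz])
    fix x y t v :: 'a assume "x \<noteq> 0" and nz: "ev2 (G 0) t v \<noteq> 0"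
    have tv: "(t, v) \<noteq> (0, 0)" using nz ev2_origin[OF homG[of 0]] n by auto
    have g0nz: "ev2 (g $ 0) t v \<noteq> 0" using nz by (simp add: evG0)
    show "ev4 \<rho> (cone_point G \<beta> x y t v) = 0"
      unfolding \<rho>_def ev4_Res_tv[OF A'(2) B'(2)]
    proof (rule Res_tv_eq_0[OF hom_x[OF A'(3)] hom_x[OF B'(3)] _ _ tv de])
      show "ev2 (x_eval A' (cone_point G \<beta> x y t v)) t v = 0"
        unfolding G_def by (rule moving_plane_contains[OF A'(7,6,5) ra \<alpha>0 \<beta>0 g0nz])
      show "ev2 (x_eval B' (cone_point G \<beta> x y t v)) t v = 0"
        unfolding G_def by (rule moving_plane_contains[OF B'(7,6,5) rb \<alpha>0 \<beta>0 g0nz])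
    qed
  qed

  \<comment> \<open>The resultant is nonzero\<close>
  have nz: "\<rho> \<noteq> 0"
  proof -
    obtain lam mu where lm: "Res_tv d e (A' $ 0 + Polynomial.smult [:lam:] \<gamma>) (B' $ 0 + Polynomial.smult [:mu:] \<delta>) \<noteq> 0"
      using generic_resultant_nonzero[OF A'(3) A'(4) B'(3) B'(4) A'(8) B'(8)] by auto
    define \<Delta> where "\<Delta> = ca k * cb l - ca l * cb k"
    \<comment> \<open>Cramer's rule yields a point at which the two forms specialise to the pair
      found for \<open>lam\<close> and \<open>mu\<close>; coordinate 0 is 1 and coordinate
      \<open>j\<close> is 0.\<close>
    define P where "P = (\<lambda>i. if i = 0 then 1 else if i = k then (lam * cb l - mu * ca l) / \<Delta>
      else if i = l then (mu * ca k - lam * cb k) / \<Delta> else 0)"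
    have P: "P 0 = 1" "P j = 0" "P k = (lam * cb l - mu * ca l) / \<Delta>" "P l = (mu * ca k - lam * cb k) / \<Delta>"
      using idx(2-7) by (simp_all add: P_def)
    have "ca k * P k + ca l * P l = lam * \<Delta> / \<Delta>" "cb k * P k + cb l * P l = mu * \<Delta> / \<Delta>"
      unfolding P by (simp_all add: \<Delta>_def algebra_simps flip: add_divide_distrib diff_divide_distrib)
    then have s: "ca k * P k + ca l * P l = lam" "cb k * P k + cb l * P l = mu"
      using det by (simp_all add: \<Delta>_def)
    have xe: "x_eval C P = C $ 0 + Polynomial.smult [:c' k * P k + c' l * P l:] \<eta>"
      if C: "\<And>i. i \<in> {1, 2, 3} \<Longrightarrow> C $ i = Polynomial.smult [:c' i:] \<eta>" for C :: "'a bipoly vec" and c' \<eta>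
      by (rule ev2_eq_imp) (use idx(2-7) in \<open>simp add: x_eval_def idx(1) C[OF kl(1)] C[OF kl(2)] P(1,2) algebra_simps\<close>)
    have "x_eval A' P = A' $ 0 + Polynomial.smult [:lam:] \<gamma>" "x_eval B' P = B' $ 0 + Polynomial.smult [:mu:] \<delta>"
      using xe[of A' ca \<gamma>] A'(5) xe[of B' cb \<delta>] B'(5) unfolding s by blast+
    then have "ev4 \<rho> P \<noteq> 0"
      unfolding \<rho>_def ev4_Res_tv[OF A'(2) B'(2)] using lm by simp
    then show ?thesis by auto
  qed

  \<comment> \<open>An irreducible factor as implicit equation\<close>
  obtain F where F: "Factorial_Ring.irreducible F" "F dvd \<rho>" "vanishes_on_cone G \<beta> F"
    using irreducible_factor_vanishing[OF nz van] by blast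
  obtain dF where dF: "homogeneous4 dF F" using vanishing_generator_homogeneous[OF F(1,3)] by blast
  define V where "V = {p. \<exists>s u t v. (s, u) \<noteq> (0, 0) \<and> (t, v) \<noteq> (0, 0) \<and>
     p = map_vec (\<lambda>q. eval4 q (vec_of_list [s, u, t, v])) (h_vec f g) \<and> p \<noteq> 0\<^sub>v 4}"
  have image_V: "rational_image (h_vec f g) = proj_point ` V"
    unfolding rational_image_def V_def by blast
  have V: "q \<in> carrier_vec 4 \<and> q \<noteq> 0\<^sub>v 4" if "q \<in> V" for q
    using that unfolding V_def img by auto
  have "is_implicit_equation F (rational_image (h_vec f g))"
  proof (rule implicit_equation_criterion[OF F(1) dF, where V = V])
    fix x assume "x \<in> rational_image (h_vec f g)"
    then show "\<exists>q\<in>V. q \<in> carrier_vec 4 \<and> q \<noteq> 0\<^sub>v 4 \<and> x = proj_point q"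
      unfolding image_V using V by blast
  next
    fix q assume q: "q \<in> V"
    then show "q \<in> carrier_vec 4 \<and> q \<noteq> 0\<^sub>v 4 \<and> proj_point q \<in> rational_image (h_vec f g)"
      unfolding image_V using V by blast
    show "eval4 F q = 0"
      using q F(3) unfolding V_def img by (auto simp: eval4_vec vanishes_on_cone_def)
  next
    fix H assume H: "\<And>q. q \<in> V \<Longrightarrow> eval4 H q = 0"
    have "vanishes_on_cone G \<beta> H"
    proof (rule vanishes_on_cone_dense[of G, OF G0nz])
      fix x y t v :: 'a assume x: "x \<noteq> 0" and nz: "ev2 (G 0) t v \<noteq> 0"
      have tv: "(t, v) \<noteq> (0, 0)" using nz ev2_origin[OF homG[of 0]] n by auto
      have g0nz: "ev2 (g $ 0) t v \<noteq> 0" using nz by (simp add: evG0)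
      \<comment> \<open>With these values of f_0 and f_j, \<open>img\<close> turns the value of
        \<open>h\<close> at (s, u, t, v) into exactly the given cone point.\<close>
      obtain s u where su: "(s, u) \<noteq> (0, 0)" "ev2 (f $ 0) s u = x" "ev2 (f $ j) s u = y / ev2 (g $ 0) t v"
        using binary_pair_onto[OF m homf[of 0] homf[OF j4(1)] cop x] by auto
      let ?q = "vec 4 (cone_point G \<beta> x y t v)"
      \<comment> \<open>The vertex has entry 0 at index 0, so this coordinate is x G_0(t,v) and the
        vector represents a point.\<close>
      have "?q $ 0 \<noteq> 0" using x nz by (simp add: cone_point_def \<beta>0)
      then have "?q \<noteq> 0\<^sub>v 4" by (metis index_zero_vec(1) zero_less_numeral)
      moreover have "?q = map_vec (\<lambda>q. eval4 q (vec_of_list [s, u, t, v])) (h_vec f g)"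
        unfolding img su(2,3) using g0nz by simp
      ultimately have "?q \<in> V" unfolding V_def using su(1) tv by blast
      then have "eval4 H ?q = 0" by (rule H)
      then show "ev4 H (cone_point G \<beta> x y t v) = 0" by (simp only: eval4_vec)
    qed
    then show "F dvd H" using vanishing_ideal_principal[OF F(1,3)] by blast
  qed
  moreover obtain E where "\<rho> = E * F" using F(2) by (metis dvdE mult.commute)
  ultimately show ?thesis
    using A'(1) B'(1) homogeneous2_x_mult[OF A'(2,3)] homogeneous2_x_mult[OF B'(2,3)] nz
    unfolding \<rho>_def by blast
qed

end
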